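(* Let $N\ge 1000$ and $Q_0\in[2,\sqrt N]$ be real numbers. Let $(u_p)_{p\le N}$ be a sequence of complex numbers indexed by the primes $p\le N$. Then $$\sum_{q\le Q_0}\ \sum_{\substack{1\le a\le q\\ (a,q)=1}}\ \max_{|\alpha-\frac aq|\le\frac{1}{qQ_0}}\Bigl|\sum_{p\le N}u_p e(\alpha p)\Bigr|^2\le 1200\,\frac{N\log Q_0}{\log N}\sum_{p\le N}|u_p|^2,$$ where $q$ runs over the positive integers at most $Q_0$ and the maximum is over real $\alpha$.
   Context: The variable $p$ always denotes a prime number, and sums over $p\le N$ run over primes. We write $e(\alpha)=\exp(2i\pi\alpha)$, and $(a,q)$ is the greatest common divisor of $a$ and $q$. *)

theory Defs
  imports "HOL-Analysis.Analysis" "HOL-Computational_Algebra.Primes"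
begin

definition e :: "real \<Rightarrow> complex" where
  "e \<alpha> = exp (2 * \<i> * of_real pi * of_real \<alpha>)"

definition primes_upto :: "real \<Rightarrow> nat set" where
  "primes_upto N = {p. prime p \<and> real p \<le> N}"

definition prime_exp_sum :: "real \<Rightarrow> (nat \<Rightarrow> complex) \<Rightarrow> real \<Rightarrow> complex" where
  "prime_exp_sum N u \<alpha> = (\<Sum>p\<in>primes_upto N. u p * e (\<alpha> * real p))"

definition arc :: "real \<Rightarrow> nat \<Rightarrow> nat \<Rightarrow> real set" where
  "arc Q\<^sub>0 q a = {\<alpha>. \<bar>\<alpha> - real a / real q\<bar> \<le> 1 / (real q * Q\<^sub>0)}"

text \<open>The maximum is rendered as a supremum (\<open>Max\<close> is only meaningful on finite
  sets). The lemma below shows that this supremum is a genuine maximum, for all the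
  parameters that occur.\<close>

definition arc_max :: "real \<Rightarrow> (nat \<Rightarrow> complex) \<Rightarrow> real \<Rightarrow> nat \<Rightarrow> nat \<Rightarrow> real" where
  "arc_max N u Q\<^sub>0 q a = (SUP \<alpha>\<in>arc Q\<^sub>0 q a. (norm (prime_exp_sum N u \<alpha>))\<^sup>2)"

lemma arc_max_attained:
  assumes "Q\<^sub>0 > 0"
  shows "\<exists>\<alpha>\<in>arc Q\<^sub>0 q a. arc_max N u Q\<^sub>0 q a = (norm (prime_exp_sum N u \<alpha>))\<^sup>2 \<and>
           (\<forall>\<beta>\<in>arc Q\<^sub>0 q a. (norm (prime_exp_sum N u \<beta>))\<^sup>2 \<le> (norm (prime_exp_sum N u \<alpha>))\<^sup>2)"
proof -
  let ?f = "\<lambda>\<alpha>. (norm (prime_exp_sum N u \<alpha>))\<^sup>2"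
  have arc: "arc Q\<^sub>0 q a = cball (real a / real q) (1 / (real q * Q\<^sub>0))"
    by (auto simp: arc_def dist_real_def abs_minus_commute)
  have "1 / (real q * Q\<^sub>0) \<ge> 0"
    using assms by simp
  then have "compact (arc Q\<^sub>0 q a)" "arc Q\<^sub>0 q a \<noteq> {}"
    unfolding arc by (simp_all only: compact_cball cball_eq_empty not_less)
  moreover have "continuous_on (arc Q\<^sub>0 q a) ?f"
    unfolding prime_exp_sum_def e_def by (intro continuous_intros)
  ultimately obtain \<alpha> where \<alpha>: "\<alpha> \<in> arc Q\<^sub>0 q a" "\<forall>\<beta>\<in>arc Q\<^sub>0 q a. ?f \<beta> \<le> ?f \<alpha>"
    using continuous_attains_sup by blast
  have "arc_max N u Q\<^sub>0 q a = ?f \<alpha>"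
    unfolding arc_max_def using \<alpha> by (intro cSup_eq_maximum) auto
  with \<alpha> show ?thesis by blast
qed

end

theory Submission
  imports Defs "HOL-Number_Theory.Totient" "HOL-Computational_Algebra.Squarefree"
begin

text \<open>
  Pick in each arc a point \<open>\<alpha>\<^sub>i\<close> at which the maximum is attained. By duality (\<open>dual_to_primal\<close>) the claim
  is a mean value bound over primes for the polynomials \<open>T n = (\<Sum>i. b i * e (\<alpha>\<^sub>i * n))\<close>, namely
  \<open>(\<Sum>p\<le>N. \<bar>T p\<bar>\<^sup>2) \<le> D * (\<Sum>i. \<bar>b i\<bar>\<^sup>2)\<close>. Dropping the primality of \<open>p\<close>, the large sieve gives
  this with \<open>D\<close> of order \<open>N\<close>, because a window of length \<open>1/N\<close> meets the points of at most four Farey arcs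
  (\<open>farey_arc_cluster\<close>). The extra factor \<open>ln Q\<^sub>0 / ln N\<close> comes from a sieve.

  Put \<open>z = \<lfloor>Q\<^sub>0\<rfloor>\<^sup>2\<close> and let \<open>R\<close> be about \<open>N\<close> to the power \<open>1/4\<close>. Let \<open>r\<close> run over the squarefree numbers
  up to \<open>R\<close> that have only prime factors exceeding \<open>z\<close>, let \<open>L\<close> be the sum of the \<open>1 / \<phi>(r)\<close>, and put
  \<open>K n = (\<Sum>r. \<mu>(r) / \<phi>(r) * c\<^sub>r(n))\<close> with Ramanujan's sums \<open>c\<^sub>r(n)\<close>. A prime \<open>p > R\<close> is coprime to every
  \<open>r\<close>, so \<open>c\<^sub>r(p) = \<mu>(r)\<close> and \<open>K p = L\<close>. Hence \<open>L\<^sup>2\<close> times the sum of \<open>\<bar>T p\<bar>\<^sup>2\<close> over these primes is at most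
  the sum of \<open>\<bar>K n * T n\<bar>\<^sup>2\<close> over all \<open>n \<le> N\<close>. Now \<open>K * T\<close> is an exponential polynomial with frequencies
  \<open>\<alpha>\<^sub>i + b/r\<close>, and its mean square is a quadratic form in the values of the Fejer kernel at the differences
  of these frequencies (\<open>weighted_mean_square_le_fejer\<close>). Pairs with equal fractions \<open>b/r\<close> contribute \<open>L\<close>
  times the ordinary large sieve. For two different fractions, some prime \<open>p > z\<close> divides the denominator of
  the difference; the pairs of fractions with one given difference then have total weight at most \<open>3 L / z\<close>
  (\<open>sum_wt_prod_le\<close>), while distinct differences are at least \<open>1/R^4 \<ge> 1/N\<close> apart, so they also form
  a well-spaced family. Since there are at most \<open>z/2\<close> points \<open>\<alpha>\<^sub>i\<close>, even the trivial
  treatment of the pairs \<open>(i, j)\<close> costs a bounded factor only. This gives \<open>D\<close> of order \<open>N / L\<close>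
  (\<open>sieved_dual_large_sieve\<close>). Sieving by primes exceeding \<open>z\<close> only is what makes the off-diagonal
  terms harmless.

  It remains to bound \<open>L\<close> from below. Removing the primes up to \<open>z\<close> from the harmonic sum up to \<open>R\<close> costs at
  most the product of the factors \<open>p / (p - 1)\<close>, \<open>p \<le> z\<close>, so \<open>L\<close> is at least \<open>ln (R + 1)\<close> divided by this
  product (\<open>sieve_mass_lower\<close>), and the product is at most \<open>4.7 * ln z\<close>, hence at most \<open>9.4 * ln Q\<^sub>0\<close>
  (\<open>mertens_prod_le\<close>). Altogether the constant is \<open>17/3 * (4 + 3/2) * 4 * 9.4 < 1172\<close>; the primes up to \<open>R\<close>
  are estimated trivially and fit into the remaining \<open>28\<close>. This needs \<open>Q\<^sub>0\<^sup>4 \<le> N\<close>; in the opposite case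
  \<open>ln Q\<^sub>0 / ln N\<close> exceeds \<open>1/4\<close> and the bound without sieving (\<open>R = 1\<close>) suffices.
\<close>

section \<open>Exponential sums and the Fejer kernel\<close>

lemma e_add: "e (x + y) = e x * e y"
  by (simp add: e_def distrib_left exp_add)

lemma e_0 [simp]: "e 0 = 1"
  by (simp add: e_def)

lemma e_of_int [simp]: "e (of_int k) = 1"
  unfolding e_def by (subst exp_eq_1) (auto simp: algebra_simps)

lemma norm_e [simp]: "norm (e x) = 1"
  unfolding e_def by (simp add: norm_exp_eq_Re)

lemma e_diff: "e (x - y) = e x * cnj (e y)"
  using e_add[of x "- y"] by (simp add: e_def exp_cnj)

lemma e_mult_of_nat: "e (real n * x) = e x ^ n"
  by (induction n) (simp_all add: distrib_right e_add)

text \<open>The function \<open>2 * x - sin (pi * x)\<close> is convex on \<open>[0, 1/2]\<close> and vanishes at both ends.\<close>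
lemma jordan_sin_ge:
  assumes "0 \<le> x" "x \<le> 1/2"
  shows "2 * x \<le> sin (pi * x)"
proof -
  have conv: "convex_on {0..1/2} (\<lambda>x::real. 2 * x - sin (pi * x))"
  proof (rule f''_ge0_imp_convex[where f' = "\<lambda>x. 2 - pi * cos (pi * x)" and f'' = "\<lambda>x. pi * pi * sin (pi * x)"])
    show "convex {0..1/2::real}" by simp
    fix x :: real assume x: "x \<in> {0..1/2}"
    show "((\<lambda>x. 2 * x - sin (pi * x)) has_real_derivative 2 - pi * cos (pi * x)) (at x)"
      by (auto intro!: derivative_eq_intros)
    show "((\<lambda>x. 2 - pi * cos (pi * x)) has_real_derivative pi * pi * sin (pi * x)) (at x)"
      by (auto intro!: derivative_eq_intros)
    have "0 \<le> pi * x" "pi * x \<le> pi" using x mult_left_mono[of x 1 pi] by auto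
    then show "0 \<le> pi * pi * sin (pi * x)" by (auto intro!: mult_nonneg_nonneg sin_ge_zero)
  qed
  have "2 * x - sin (pi * x) \<le> 0"
    using convex_onD[OF conv, of "2*x" 0 "1/2"] assms by (simp add: sin_pi_half)
  then show ?thesis by simp
qed

text \<open>The Fejer kernel, without the usual normalisation by \<open>1/M\<close>.\<close>
definition fejer :: "nat \<Rightarrow> real \<Rightarrow> real" where
  "fejer M \<theta> = (norm (\<Sum>h<M. e (real h * \<theta>)))\<^sup>2"

lemma fejer_nonneg: "fejer M \<theta> \<ge> 0"
  by (simp add: fejer_def)

lemma fejer_le_square: "fejer M \<theta> \<le> (real M)\<^sup>2"
proof -
  have "norm (\<Sum>h<M. e (real h * \<theta>)) \<le> (\<Sum>h<M. norm (e (real h * \<theta>)))" by (rule norm_sum)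
  then show ?thesis unfolding fejer_def by (intro power_mono) auto
qed

text \<open>On the unit circle \<open>\<bar>e x - 1\<bar> = 2 * \<bar>sin (pi * x)\<bar>\<close>; reducing \<open>\<theta>\<close> modulo 1 to \<open>x\<close> in
  \<open>[-1/2, 1/2]\<close> makes Jordan's inequality applicable.\<close>
lemma norm_e_minus_1_ge:
  assumes "\<theta> + of_int k = x" "\<bar>x\<bar> \<le> 1/2"
  shows "4 * \<bar>x\<bar> \<le> norm (e \<theta> - 1)"
proof -
  have "e \<theta> = e x" using assms(1)[symmetric] by (simp add: e_add)
  moreover have "e x = exp (\<i> * of_real (2 * pi * x))" by (simp add: e_def mult_ac)
  ultimately have "norm (e \<theta> - 1) = 2 * \<bar>sin (pi * x)\<bar>"
    using dist_exp_i_1[of "2 * pi * x"] by simp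
  moreover have "2 * \<bar>x\<bar> \<le> sin (pi * \<bar>x\<bar>)" using jordan_sin_ge[of "\<bar>x\<bar>"] assms by auto
  moreover have "sin (pi * \<bar>x\<bar>) \<le> \<bar>sin (pi * x)\<bar>" by (cases "x \<ge> 0") auto
  ultimately show ?thesis by linarith
qed

text \<open>The geometric sum is \<open>(e (M * \<theta>) - 1) / (e \<theta> - 1)\<close>: the numerator is at most 2 and the
  denominator at least \<open>4 * \<bar>x\<bar>\<close>. The free parameter \<open>y\<close> replaces \<open>\<bar>x\<bar>\<close> by a convenient lower
  bound.\<close>
lemma fejer_decay:
  assumes "\<theta> + of_int k = x" "\<bar>x\<bar> \<le> 1/2" "0 < y" "y \<le> \<bar>x\<bar>"
  shows "fejer M \<theta> \<le> 1 / (4 * y\<^sup>2)"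
proof -
  let ?S = "\<Sum>h<M. e (real h * \<theta>)"
  have "?S * (e \<theta> - 1) = e \<theta> ^ M - 1"
    unfolding e_mult_of_nat by (metis mult.commute power_diff_1_eq)
  then have "norm ?S * norm (e \<theta> - 1) = norm (e \<theta> ^ M - 1)" by (metis norm_mult)
  also have "\<dots> \<le> 2" using norm_triangle_ineq4[of "e \<theta> ^ M" 1] by (simp add: norm_power)
  finally have *: "norm ?S * norm (e \<theta> - 1) \<le> 2" .
  have "4 * y \<le> norm (e \<theta> - 1)" using norm_e_minus_1_ge[OF assms(1,2)] assms(4) by linarith
  then have "norm ?S * (4 * y) \<le> norm ?S * norm (e \<theta> - 1)" by (intro mult_left_mono) auto
  with * have "norm ?S * y * 4 \<le> 2" by (simp only: mult_ac)
  then have "norm ?S * y \<le> 1/2" by linarith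
  then have "norm ?S \<le> (1/2) / y" using assms(3) by (simp only: pos_le_divide_eq)
  then have "norm ?S \<le> 1 / (2 * y)" by simp
  then have "(norm ?S)\<^sup>2 \<le> (1 / (2 * y))\<^sup>2" by (intro power_mono) auto
  then show ?thesis by (simp add: fejer_def power_divide power_mult_distrib)
qed

text \<open>Telescoping against \<open>1 / (T - 1/2) - 1 / (T + 1/2) = 1 / (T\<^sup>2 - 1/4)\<close> from the second term on;
  the constant is \<open>1 + 1 / (3/2)\<close>.\<close>
lemma sum_inverse_squares_le: "T \<ge> 1 \<Longrightarrow> (\<Sum>t = 1..T. 1 / (real t)\<^sup>2) \<le> 5/3 - 1 / (real T + 1/2)"
proof (induction T rule: dec_induct)
  case (step T)
  have "1 / (real (Suc T))\<^sup>2 \<le> 1 / (real T + 1/2) - 1 / (real (Suc T) + 1/2)"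
  proof -
    have "1 / (real T + 1/2) - 1 / (real (Suc T) + 1/2) = 1 / ((real T + 1/2) * (real T + 3/2))"
      by (simp add: divide_simps) (simp add: algebra_simps)?
    moreover have "(real T + 1/2) * (real T + 3/2) \<le> (real (Suc T))\<^sup>2"
      by (simp add: power2_eq_square algebra_simps)
    ultimately show ?thesis by (simp add: frac_le)
  qed
  then show ?case using step by simp
qed (simp add: field_simps)

lemma sum_bin_weights_le:
  "(\<Sum>s<M. if s = 0 then 1 else 1 / (4 * (real s)\<^sup>2)) \<le> 17/12"
proof (cases "M \<le> 1")
  case True
  then have "M = 0 \<or> M = 1" by auto
  then show ?thesis by auto
next
  case False
  have "{..<M} = insert 0 {1..M-1}" using False by auto
  then have "(\<Sum>s<M. if s = 0 then 1 else 1 / (4 * (real s)\<^sup>2)) = 1 + (\<Sum>s=1..M-1. 1 / (4 * (real s)\<^sup>2))"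
    by simp
  also have "(\<Sum>s=1..M-1. 1 / (4 * (real s)\<^sup>2)) = (\<Sum>s=1..M-1. 1 / (real s)\<^sup>2) / 4"
    by (simp add: sum_divide_distrib mult.commute)
  also have "(\<Sum>s=1..M-1. 1 / (real s)\<^sup>2) \<le> 5/3"
    using sum_inverse_squares_le[of "M-1"] False by (smt (verit) of_nat_0_le_iff diff_is_0_eq less_one not_le zero_le_divide_1_iff)
  finally show ?thesis by simp
qed

text \<open>The quantitative form of well-spacing used throughout: assume that every family of points that
  lie, modulo 1, in one common window of length \<open>1/M\<close> has weight at most \<open>B\<close>. The maxima of the
  Fejer kernel over consecutive windows of this length decay like \<open>M\<^sup>2 / (4 * s\<^sup>2)\<close>, so they add
  up to \<open>O(M\<^sup>2)\<close>. The lemma is applied twice, to the points in the arcs with weight 1 and to the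
  differences of sieve fractions with their weights.\<close>
lemma cluster_bound:
  fixes \<theta> :: "'a \<Rightarrow> real" and c :: "'a \<Rightarrow> real"
  assumes "finite J" "M > 0" and c: "\<And>j. j \<in> J \<Longrightarrow> c j \<ge> 0"
    and cl: "\<And>S z k. S \<subseteq> J \<Longrightarrow> (\<And>j. j \<in> S \<Longrightarrow> z \<le> \<theta> j + of_int (k j) \<and> \<theta> j + of_int (k j) < z + 1 / real M)
               \<Longrightarrow> sum c S \<le> B"
  shows "(\<Sum>j\<in>J. c j * fejer M (\<theta> j)) \<le> 17/6 * (real M)\<^sup>2 * B"
proof -
  \<comment> \<open>Reduce to \<open>x j\<close> in \<open>[-1/2, 1/2)\<close>; the window of index \<open>t j\<close> contains \<open>x j\<close>, and \<open>s j\<close> counts the full windows that separate it from 0.\<close>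
  define k where "k j = - \<lfloor>\<theta> j + 1/2\<rfloor>" for j
  define x where "x j = \<theta> j + of_int (k j)" for j
  define t where "t j = \<lfloor>real M * x j\<rfloor>" for j
  define s where "s j = nat (if t j \<ge> 0 then t j else - t j - 1)" for j
  define w where "w s = (if s = 0 then 1 else 1 / (4 * (real s)\<^sup>2))" for s :: nat
  have x: "- 1/2 \<le> x j" "x j < 1/2" for j unfolding x_def k_def by linarith+
  have M: "real M > 0" using assms by simp
  have t: "of_int (t j) \<le> real M * x j" "real M * x j < of_int (t j) + 1" for j
    unfolding t_def by linarith+
  have sM: "s j < M" for j
  proof -
    have "real M * x j \<ge> real M * (-1/2)" "real M * x j \<le> real M * (1/2)"
      using x[of j] M by (intro mult_left_mono; linarith)+
    then have "t j < int M" "- t j - 1 < int M" using t[of j] M by linarith+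
    then show ?thesis unfolding s_def using assms(2) by auto
  qed
  have kw: "fejer M (\<theta> j) \<le> (real M)\<^sup>2 * w (s j)" for j
  proof (cases "s j = 0")
    case True
    then show ?thesis using fejer_le_square by (simp add: w_def)
  next
    case False
    have "real (s j) \<le> real M * \<bar>x j\<bar>"
    proof (cases "t j \<ge> 0")
      case True
      then have "real (s j) = of_int (t j)" by (simp add: s_def)
      also have "\<dots> \<le> real M * x j" by (rule t)
      also have "\<dots> \<le> real M * \<bar>x j\<bar>" using M by (intro mult_left_mono) auto
      finally show ?thesis .
    next
      case neg: False
      then have "real (s j) = of_int (- t j - 1)" by (simp add: s_def)
      also have "\<dots> \<le> real M * (- x j)" using t[of j] by simp
      also have "\<dots> \<le> real M * \<bar>x j\<bar>" using M by (intro mult_left_mono) auto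
      finally show ?thesis .
    qed
    then have "real (s j) / real M \<le> \<bar>x j\<bar>" using M by (simp add: field_simps)
    moreover have "\<bar>x j\<bar> \<le> 1/2" using x[of j] by linarith
    ultimately have "fejer M (\<theta> j) \<le> 1 / (4 * (real (s j) / real M)\<^sup>2)"
      using False M by (intro fejer_decay[of "\<theta> j" "k j" "x j"]) (auto simp: x_def)
    also have "\<dots> = (real M)\<^sup>2 * w (s j)" using False M by (simp add: w_def field_simps)
    finally show ?thesis .
  qed
  define bins where "bins = (UNIV :: bool set) \<times> {..<M}"
  define bin where "bin j = (t j \<ge> 0, s j)" for j
  have B: "(\<Sum>j | j \<in> J \<and> bin j = \<beta>. c j) \<le> B" for \<beta>
  proof -
    obtain b \<sigma> where \<beta>: "\<beta> = (b, \<sigma>)" by force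
    define \<tau> where "\<tau> = (if b then int \<sigma> else - int \<sigma> - 1)"
    have tt: "t j = \<tau>" if "bin j = \<beta>" for j
      using that unfolding bin_def \<beta> \<tau>_def s_def by (auto split: if_splits)
    show ?thesis
    proof (rule cl[where z = "of_int \<tau> / real M" and k = k])
      fix j assume "j \<in> {j \<in> J. bin j = \<beta>}"
      then have "t j = \<tau>" using tt by simp
      then show "of_int \<tau> / real M \<le> \<theta> j + of_int (k j) \<and> \<theta> j + of_int (k j) < of_int \<tau> / real M + 1 / real M"
        using t[of j] M unfolding x_def by (simp add: field_simps)
    qed auto
  qed
  have "B \<ge> 0" using cl[of "{}" 0] by simp
  have "(\<Sum>j\<in>J. c j * fejer M (\<theta> j)) \<le> (\<Sum>j\<in>J. c j * ((real M)\<^sup>2 * w (s j)))"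
    using c kw by (intro sum_mono mult_left_mono) auto
  also have "\<dots> = (\<Sum>\<beta>\<in>bins. \<Sum>j | j \<in> J \<and> bin j = \<beta>. c j * ((real M)\<^sup>2 * w (s j)))"
    using sM by (intro sum.group[symmetric] assms) (auto simp: bins_def bin_def)
  also have "\<dots> = (\<Sum>\<beta>\<in>bins. (\<Sum>j | j \<in> J \<and> bin j = \<beta>. c j) * ((real M)\<^sup>2 * w (snd \<beta>)))"
    unfolding sum_distrib_right by (intro sum.cong) (auto simp: bin_def)
  also have "\<dots> \<le> (\<Sum>\<beta>\<in>bins. B * ((real M)\<^sup>2 * w (snd \<beta>)))"
    using B by (intro sum_mono mult_right_mono) (auto simp: w_def)
  also have "\<dots> = (\<Sum>b\<in>(UNIV::bool set). \<Sum>\<sigma><M. B * ((real M)\<^sup>2 * w \<sigma>))"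
    unfolding bins_def by (subst sum.cartesian_product) (simp add: case_prod_unfold)
  also have "\<dots> = 2 * (B * (real M)\<^sup>2) * (\<Sum>\<sigma><M. w \<sigma>)"
    by (simp add: sum_distrib_left[symmetric] UNIV_bool)
  also have "\<dots> \<le> 2 * (B * (real M)\<^sup>2) * (17/12)"
    using sum_bin_weights_le[of M] \<open>B \<ge> 0\<close> unfolding w_def by (intro mult_left_mono) auto
  finally show ?thesis by (simp add: mult_ac)
qed

text \<open>Majorising the indicator of \<open>{1..M}\<close> by a Fejer weight: \<open>n\<close> is represented as \<open>h - h' + n0\<close>,
  with \<open>n0\<close> the midpoint of the interval, in at least \<open>M/2\<close> ways.\<close>
lemma sum_le_double_sum:
  fixes g :: "int \<Rightarrow> real"
  assumes "\<And>n. g n \<ge> 0"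
  shows "(real M / 2) * (\<Sum>n=1..M. g (int n)) \<le> (\<Sum>h<M. \<Sum>h'<M. g (int h - int h' + int ((M + 1) div 2)))"
proof -
  define n0 where "n0 = (M + 1) div 2"
  define A where "A = {1..M} \<times> {..<n0}"
  \<comment> \<open>With truncated subtraction, the two components differ by \<open>n - n0\<close>.\<close>
  define \<phi> where "\<phi> = (\<lambda>(n, s). (s + (n - n0), s + (n0 - n)))"
  have inj: "inj_on \<phi> A"
    unfolding \<phi>_def A_def by (auto intro!: inj_onI)
  have sub: "\<phi> ` A \<subseteq> {..<M} \<times> {..<M}"
    unfolding \<phi>_def A_def n0_def by auto
  have "(real M / 2) * (\<Sum>n=1..M. g (int n)) \<le> real n0 * (\<Sum>n=1..M. g (int n))"
    using assms by (intro mult_right_mono sum_nonneg) (auto simp: n0_def)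
  also have "\<dots> = (\<Sum>n=1..M. \<Sum>s<n0. g (int n))" unfolding sum_distrib_left by (intro sum.cong) auto
  also have "\<dots> = (\<Sum>x\<in>A. g (int (fst x)))" unfolding A_def by (subst sum.cartesian_product) (simp only: case_prod_unfold)
  also have "\<dots> = (\<Sum>x\<in>A. g (int (fst (\<phi> x)) - int (snd (\<phi> x)) + int n0))"
    by (intro sum.cong arg_cong[where f = g]) (auto simp: \<phi>_def)
  also have "\<dots> = (\<Sum>y\<in>\<phi> ` A. g (int (fst y) - int (snd y) + int n0))"
    using inj by (simp add: sum.reindex)
  also have "\<dots> \<le> (\<Sum>y\<in>{..<M} \<times> {..<M}. g (int (fst y) - int (snd y) + int n0))"
    using assms sub by (intro sum_mono2) auto
  also have "\<dots> = (\<Sum>h<M. \<Sum>h'<M. g (int h - int h' + int n0))"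
    by (simp add: sum.cartesian_product case_prod_unfold)
  finally show ?thesis by (simp add: n0_def)
qed

lemma norm_sum_square:
  fixes f :: "'a \<Rightarrow> complex"
  shows "complex_of_real ((norm (\<Sum>j\<in>J. f j))\<^sup>2) = (\<Sum>j\<in>J. \<Sum>j'\<in>J. f j * cnj (f j'))"
  by (simp only: complex_norm_square cnj_sum sum_product)

text \<open>Expanding the square and summing over \<open>h\<close> and \<open>h'\<close> turns the mean square into a quadratic form
  whose coefficients are unimodular multiples of Fejer kernel values.\<close>
lemma weighted_mean_square_le_fejer:
  fixes w :: "'a \<Rightarrow> complex" and \<theta> :: "'a \<Rightarrow> real"
  shows "real M * (\<Sum>n=1..M. (norm (\<Sum>j\<in>J. w j * e (\<theta> j * real n)))\<^sup>2)
           \<le> 2 * (\<Sum>j\<in>J. \<Sum>j'\<in>J. norm (w j) * norm (w j') * fejer M (\<theta> j - \<theta> j'))"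
proof -
  define g where "g n = (norm (\<Sum>j\<in>J. w j * e (\<theta> j * of_int n)))\<^sup>2" for n :: int
  define n0 where "n0 = int ((M + 1) div 2)"
  have gc: "complex_of_real (g n) = (\<Sum>j\<in>J. \<Sum>j'\<in>J. w j * cnj (w j') * e ((\<theta> j - \<theta> j') * of_int n))" for n
    unfolding g_def norm_sum_square
    by (intro sum.cong refl) (simp add: left_diff_distrib right_diff_distrib e_diff mult_ac)
  have kc: "complex_of_real (fejer M x) = (\<Sum>h<M. \<Sum>h'<M. e (x * of_int (int h - int h')))" for x
    unfolding fejer_def norm_sum_square
    by (intro sum.cong refl) (simp add: right_diff_distrib e_diff mult_ac)
  have "complex_of_real (\<Sum>h<M. \<Sum>h'<M. g (int h - int h' + n0))
        = (\<Sum>h<M. \<Sum>h'<M. \<Sum>j\<in>J. \<Sum>j'\<in>J. w j * cnj (w j') * e ((\<theta> j - \<theta> j') * of_int (int h - int h' + n0)))"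
    by (simp only: of_real_sum gc)
  also have "\<dots> = (\<Sum>j\<in>J. \<Sum>j'\<in>J. \<Sum>h<M. \<Sum>h'<M. w j * cnj (w j') * e ((\<theta> j - \<theta> j') * of_int (int h - int h' + n0)))"
    by (subst (2) sum.swap, subst sum.swap, rule sum.cong[OF refl], subst (2) sum.swap, subst sum.swap, rule refl)
  also have "\<dots> = (\<Sum>j\<in>J. \<Sum>j'\<in>J. w j * cnj (w j') * e ((\<theta> j - \<theta> j') * of_int n0) * of_real (fejer M (\<theta> j - \<theta> j')))"
    unfolding kc by (simp add: sum_distrib_left distrib_left e_add mult_ac)
  finally have eq: "complex_of_real (\<Sum>h<M. \<Sum>h'<M. g (int h - int h' + n0)) = \<dots>" .
  have "(\<Sum>h<M. \<Sum>h'<M. g (int h - int h' + n0)) \<le> norm (complex_of_real (\<Sum>h<M. \<Sum>h'<M. g (int h - int h' + n0)))"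
    by (simp only: norm_of_real abs_ge_self)
  also have "\<dots> \<le> (\<Sum>j\<in>J. \<Sum>j'\<in>J. norm (w j) * norm (w j') * fejer M (\<theta> j - \<theta> j'))"
    unfolding eq
    by (intro order.trans[OF norm_sum] sum_mono) (simp add: norm_mult fejer_nonneg)
  finally have "(\<Sum>h<M. \<Sum>h'<M. g (int h - int h' + n0)) \<le> \<dots>" .
  moreover have "(real M / 2) * (\<Sum>n=1..M. g (int n)) \<le> (\<Sum>h<M. \<Sum>h'<M. g (int h - int h' + n0))"
    unfolding n0_def by (rule sum_le_double_sum) (simp add: g_def)
  ultimately show ?thesis by (simp add: g_def)
qed

section \<open>Ramanujan sums and the sieve fractions\<close>

lemma e_eq_1_iff: "e x = 1 \<longleftrightarrow> x \<in> \<int>"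
proof
  assume "e x = 1"
  then obtain n :: int where "2 * pi * x = of_int (2 * n) * pi"
    unfolding e_def exp_eq_1 by auto
  then have "x = of_int n" by simp
  then show "x \<in> \<int>" by simp
qed (auto elim!: Ints_cases)

lemma divide_in_Ints_imp_dvd:
  assumes "real_of_int a / real_of_int b \<in> \<int>" "b \<noteq> 0"
  shows "b dvd a"
proof -
  obtain k where "real_of_int a / real_of_int b = of_int k" using assms(1) by (auto elim: Ints_cases)
  then have "real_of_int a = of_int (k * b)" using assms(2) by (simp add: field_simps)
  then have "a = k * b" by (simp only: of_int_eq_iff)
  then show ?thesis by simp
qed

lemma sum_e_multiples_eq_0:
  assumes "\<not> p dvd n" "p > 0"
  shows "(\<Sum>j<p. e (real j * (real n / real p))) = 0"
proof -
  let ?w = "e (real n / real p)"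
  have "?w \<noteq> 1"
  proof
    assume "?w = 1"
    then have "real_of_int (int n) / real_of_int (int p) \<in> \<int>" by (simp add: e_eq_1_iff)
    then have "int p dvd int n" using assms(2) by (intro divide_in_Ints_imp_dvd) auto
    with assms(1) show False by simp
  qed
  moreover have "?w ^ p = 1"
    using assms(2) e_of_int[of "int n"] by (simp flip: e_mult_of_nat)
  moreover have "(?w - 1) * (\<Sum>j<p. ?w ^ j) = ?w ^ p - 1" by (simp only: power_diff_1_eq)
  ultimately have "(\<Sum>j<p. ?w ^ j) = 0" by simp
  then show ?thesis by (simp only: e_mult_of_nat)
qed

definition ramanujan_sum :: "nat \<Rightarrow> nat \<Rightarrow> complex" where
  "ramanujan_sum r n = (\<Sum>b\<in>totatives r. e (real b / real r * real n))"

lemma coprime_add_multiple_iff: "coprime (x + s * k) s \<longleftrightarrow> coprime x s" for x s k :: nat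
  using gcd_add_mult[of s k x] by (simp add: coprime_iff_gcd_eq_1 gcd.commute add.commute mult.commute)

text \<open>Residues are represented in \<open>{1..s}\<close>, as for \<open>totatives\<close>, which explains the shift by one.\<close>
lemma residue_in_totatives:
  assumes "b > 0" "coprime b s" "s > 0"
  shows "(b - 1) mod s + 1 \<in> totatives s"
proof -
  have eq: "(b - 1) mod s + 1 + s * ((b - 1) div s) = b" using assms by simp
  have "coprime ((b - 1) mod s + 1 + s * ((b - 1) div s)) s" unfolding eq by (rule assms)
  then have "coprime ((b - 1) mod s + 1) s" unfolding coprime_add_multiple_iff .
  then show ?thesis using assms(3) by (simp add: in_totatives_iff Suc_leI)
qed

text \<open>Write \<open>b = c + s * j\<close> with \<open>c\<close> reduced modulo \<open>s\<close> and \<open>j < p\<close>; the sum over \<open>j\<close> runs through all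
  \<open>p\<close>-th roots of unity.\<close>
lemma sum_coprime_residues_eq_0:
  assumes "prime p" "\<not> p dvd n" "s > 0"
  shows "(\<Sum>b | b \<in> {0<..p * s} \<and> coprime b s. e (real b / real (p * s) * real n)) = 0"
proof -
  have p: "p > 0" using assms(1) by (rule prime_gt_0_nat)
  have "(\<Sum>b | b \<in> {0<..p * s} \<and> coprime b s. e (real b / real (p * s) * real n))
      = (\<Sum>(c, j)\<in>totatives s \<times> {..<p}. e (real (c + s * j) / real (p * s) * real n))"
  proof (rule sum.reindex_bij_witness[where j = "\<lambda>b. ((b - 1) mod s + 1, (b - 1) div s)" and i = "\<lambda>(c, j). c + s * j"], goal_cases)
    case (1 b)
    then show ?case by (simp add: algebra_simps) 
  next
    case (2 b)
    then have b: "b > 0" "b - 1 < s * p" "coprime b s" using assms(3) p by (auto simp: mult.commute)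
    have "(b - 1) div s < p" using b by (simp add: less_mult_imp_div_less mult.commute)
    moreover have "(b - 1) mod s + 1 \<in> totatives s" using b assms(3) by (intro residue_in_totatives)
    ultimately show ?case by auto
  next
    case (3 x)
    then obtain c j where x: "x = (c, j)" "c > 0" "c \<le> s" "j < p" by (auto simp: in_totatives_iff)
    have eq: "c + s * j - 1 = (c - 1) + s * j" using x by simp
    have "c - 1 < s" using x by linarith
    have "s \<noteq> 0" using assms(3) by simp
    then have "(c + s * j - 1) div s = j + (c - 1) div s" unfolding eq by (rule div_mult_self2)
    also have "(c - 1) div s = 0" using \<open>c - 1 < s\<close> by (rule div_less)
    finally have 1: "(c + s * j - 1) div s = j" by simp
    have "(c + s * j - 1) mod s = (c - 1) mod s" unfolding eq by (rule mod_mult_self2)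
    also have "\<dots> = c - 1" using \<open>c - 1 < s\<close> by (rule mod_less)
    finally have "(c + s * j - 1) mod s + 1 = c" using x by simp
    with 1 have "((c + s * j - 1) mod s + 1, (c + s * j - 1) div s) = (c, j)" by (simp only:)
    then show ?case unfolding x(1) by (simp only: prod.case)
  next
    case (4 x)
    then obtain c j where x: "x = (c, j)" "c > 0" "c \<le> s" "coprime c s" "j < p" by (auto simp: in_totatives_iff)
    have "s * (j + 1) \<le> s * p" using x by (intro mult_le_mono) auto
    then have "c + s * j \<le> p * s" using x by (simp add: algebra_simps)
    moreover have "coprime (c + s * j) s" unfolding coprime_add_multiple_iff by (rule x)
    ultimately show ?case using x by auto
  next
    case (5 b)
    have "(b - 1) mod s + 1 + s * ((b - 1) div s) = b" using 5 by simp
    then show ?case by (simp only: prod.case)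
  qed
  also have "\<dots> = (\<Sum>c\<in>totatives s. \<Sum>j<p. e (real c / real (p * s) * real n) * e (real j * (real n / real p)))"
    unfolding sum.cartesian_product using assms(3) p
    by (intro sum.cong refl) (auto simp: field_simps simp flip: e_add)
  also have "\<dots> = 0"
    using sum_e_multiples_eq_0[OF assms(2) p] by (simp flip: sum_distrib_left)
  finally show ?thesis .
qed

text \<open>The residues \<open>b\<close> modulo \<open>p * s\<close> that are coprime to \<open>s\<close> are the totatives of \<open>p * s\<close> together
  with the multiples \<open>p * c\<close>, \<open>c\<close> a totative of \<open>s\<close>; their total sum vanishes.\<close>
lemma ramanujan_sum_prime_mult:
  assumes "prime p" "\<not> p dvd n" "coprime p s" "s > 0"
  shows "ramanujan_sum (p * s) n = - ramanujan_sum s n"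
proof -
  let ?f = "\<lambda>b. e (real b / real (p * s) * real n)"
  let ?U = "{b. b \<in> {0<..p * s} \<and> coprime b s}"
  have p: "p > 0" using assms(1) by (rule prime_gt_0_nat)
  have "?U = totatives (p * s) \<union> (\<lambda>c. p * c) ` totatives s"
  proof (intro set_eqI iffI)
    fix b assume b: "b \<in> ?U"
    show "b \<in> totatives (p * s) \<union> (\<lambda>c. p * c) ` totatives s"
    proof (cases "p dvd b")
      case True
      then obtain c where "b = p * c" by blast
      then show ?thesis using b p by (auto simp: in_totatives_iff)
    next
      case False
      then have "coprime p b" using assms(1) by (simp add: prime_imp_coprime)
      then show ?thesis using b by (auto simp: in_totatives_iff coprime_commute)
    qed
  next
    fix b assume "b \<in> totatives (p * s) \<union> (\<lambda>c. p * c) ` totatives s"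
    then show "b \<in> ?U" using assms p by (auto simp: in_totatives_iff)
  qed
  moreover have "totatives (p * s) \<inter> (\<lambda>c. p * c) ` totatives s = {}"
    using assms(1) by (auto simp: in_totatives_iff)
  ultimately have "sum ?f ?U = sum ?f (totatives (p * s)) + sum ?f ((\<lambda>c. p * c) ` totatives s)"
    by (simp add: sum.union_disjoint)
  also have "sum ?f ((\<lambda>c. p * c) ` totatives s) = ramanujan_sum s n"
    unfolding ramanujan_sum_def using p by (subst sum.reindex) (auto intro!: inj_onI)
  finally show ?thesis
    using sum_coprime_residues_eq_0[OF assms(1,2,4)] by (simp add: ramanujan_sum_def add_eq_0_iff2)
qed

lemma squarefree_prime_split:
  assumes "squarefree r" "prime p" "p dvd r"
  obtains s where "r = p * s" "coprime p s" "squarefree s" "s > 0" "totient r = (p - 1) * totient s"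
proof -
  obtain s where s: "r = p * s" using assms(3) by blast
  have "\<not> p dvd s"
  proof
    assume "p dvd s"
    then have "p ^ 2 dvd r" using s by (auto simp: power2_eq_square)
    then have "is_unit p" using assms(1) by (auto simp: squarefree_def)
    then show False using assms(2) by auto
  qed
  then have c: "coprime p s" using assms(2) by (simp add: prime_imp_coprime)
  have "squarefree s" using assms(1) s by (auto simp: squarefree_def)
  moreover have "s > 0" using \<open>squarefree s\<close> by (auto intro!: Nat.gr0I)
  moreover have "totient r = (p - 1) * totient s"
    using c s assms(2) by (simp add: totient_mult_coprime totient_prime)
  ultimately show ?thesis using that s c by blast
qed

text \<open>The right-hand side is the Moebius function at the squarefree number \<open>r\<close>.\<close>
lemma ramanujan_sum_coprime:
  assumes "squarefree r" "coprime n r"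
  shows "ramanujan_sum r n = (- 1) ^ card (prime_factors r)"
  using assms
proof (induction r rule: less_induct)
  case (less r)
  show ?case
  proof (cases "r = 1")
    case True
    then show ?thesis using e_of_int[of "int n"] by (simp add: ramanujan_sum_def)
  next
    case False
    then obtain p where p: "prime p" "p dvd r" using prime_factor_nat by blast
    obtain s where s: "r = p * s" "coprime p s" "squarefree s" "s > 0"
      using squarefree_prime_split[OF less.prems(1) p] by metis
    have "s < r" using s p(1) prime_gt_1_nat[of p] by simp
    then have IH: "ramanujan_sum s n = (- 1) ^ card (prime_factors s)"
      using less.IH[of s] s less.prems by simp
    have "\<not> p dvd n" using less.prems(2) p by (meson coprime_common_divisor not_prime_unit)
    then have "ramanujan_sum r n = - ramanujan_sum s n"
      using ramanujan_sum_prime_mult[of p n s] s p by simp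
    moreover have "prime_factors r = insert p (prime_factors s)"
      using s p by (simp add: prime_factors_product prime_factorization_prime)
    moreover have "p \<notin> prime_factors s" using s(2) p(1)
      by (metis coprime_absorb_left in_prime_factors_iff not_prime_unit)
    ultimately show ?thesis using IH by simp
  qed
qed

definition sieve_moduli :: "nat \<Rightarrow> nat \<Rightarrow> nat set" where
  "sieve_moduli z R = {r. r \<le> R \<and> squarefree r \<and> (\<forall>p. prime p \<longrightarrow> p dvd r \<longrightarrow> z < p)}"

definition sieve_mass :: "nat \<Rightarrow> nat \<Rightarrow> real" where
  "sieve_mass z R = (\<Sum>r\<in>sieve_moduli z R. 1 / real (totient r))"

definition sieve_fracs :: "nat \<Rightarrow> nat \<Rightarrow> (nat \<times> nat) set" where
  "sieve_fracs z R = (SIGMA r:sieve_moduli z R. totatives r)"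

definition frac_val :: "nat \<times> nat \<Rightarrow> real" where
  "frac_val y = real (snd y) / real (fst y)"

text \<open>The absolute value of the coefficient of \<open>e (b/r * n)\<close> in the sieve polynomial \<open>K\<close>, for
  \<open>y = (r, b)\<close>.\<close>
definition frac_wt :: "nat \<times> nat \<Rightarrow> real" where
  "frac_wt y = 1 / real (totient (fst y))"

lemma finite_sieve_moduli [simp]: "finite (sieve_moduli z R)"
  by (rule finite_subset[of _ "{..R}"]) (auto simp: sieve_moduli_def)

lemma finite_sieve_fracs [simp]: "finite (sieve_fracs z R)"
  by (auto simp: sieve_fracs_def)

lemma sieve_moduli_pos: "r \<in> sieve_moduli z R \<Longrightarrow> r > 0"
  by (rule Nat.gr0I) (auto simp: sieve_moduli_def)

lemma sieve_mass_nonneg: "sieve_mass z R \<ge> 0"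
  by (auto simp: sieve_mass_def intro!: sum_nonneg)

lemma sieve_mass_ge_1: "R \<ge> 1 \<Longrightarrow> sieve_mass z R \<ge> 1"
proof -
  assume "R \<ge> 1"
  then have "(\<Sum>r\<in>{1}. 1 / real (totient r)) \<le> sieve_mass z R"
    unfolding sieve_mass_def by (intro sum_mono2) (auto simp: sieve_moduli_def)
  then show ?thesis by simp
qed

lemma frac_wt_nonneg: "frac_wt y \<ge> 0"
  by (simp add: frac_wt_def)

lemma sum_frac_wt_square: "(\<Sum>y\<in>sieve_fracs z R. (frac_wt y)\<^sup>2) = sieve_mass z R"
proof -
  have "(\<Sum>y\<in>sieve_fracs z R. (frac_wt y)\<^sup>2)
        = (\<Sum>r\<in>sieve_moduli z R. \<Sum>b\<in>totatives r. (1 / real (totient r))\<^sup>2)"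
    unfolding sieve_fracs_def by (subst sum.Sigma) (auto simp: frac_wt_def case_prod_unfold)
  also have "\<dots> = sieve_mass z R"
    unfolding sieve_mass_def
    by (intro sum.cong refl) (auto simp: totient_def power2_eq_square dest: sieve_moduli_pos)
  finally show ?thesis .
qed

text \<open>Dividing out \<open>p\<close> maps the multiples of \<open>p\<close> injectively to sieve moduli, and \<open>\<phi>\<close> is
  multiplicative.\<close>
lemma sieve_mass_multiples:
  assumes "prime p"
  shows "(\<Sum>r | r \<in> sieve_moduli z R \<and> p dvd r. 1 / real (totient r)) \<le> sieve_mass z R / real (p - 1)"
proof -
  let ?A = "{r. r \<in> sieve_moduli z R \<and> p dvd r}"
  have *: "r div p \<in> sieve_moduli z R \<and> totient r = (p - 1) * totient (r div p)" if "r \<in> ?A" for r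
  proof -
    from that have r: "squarefree r" "p dvd r" "r \<le> R" by (auto simp: sieve_moduli_def)
    obtain s where s: "r = p * s" "squarefree s" "s > 0" "totient r = (p - 1) * totient s"
      using squarefree_prime_split[OF r(1) assms r(2)] by metis
    then have "r div p = s" using assms by auto
    moreover have "s \<in> sieve_moduli z R"
      using that s assms r(3) prime_gt_0_nat[OF assms]
      by (auto simp: sieve_moduli_def intro: order.trans[of s "p * s"])
    ultimately show ?thesis using s by simp
  qed
  have "inj_on (\<lambda>r. r div p) ?A" by (auto intro!: inj_onI elim!: dvdE)
  then have "(\<Sum>s\<in>(\<lambda>r. r div p) ` ?A. 1 / real (totient s)) = (\<Sum>r\<in>?A. 1 / real (totient (r div p)))"
    by (simp add: sum.reindex)
  moreover have "(\<Sum>s\<in>(\<lambda>r. r div p) ` ?A. 1 / real (totient s)) \<le> sieve_mass z R"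
    unfolding sieve_mass_def using * by (intro sum_mono2) auto
  moreover have "(\<Sum>r\<in>?A. 1 / real (totient r)) = (\<Sum>r\<in>?A. 1 / real (totient (r div p))) / real (p - 1)"
    unfolding sum_divide_distrib using * by (intro sum.cong) (auto simp: mult.commute)
  ultimately show ?thesis by (simp add: divide_right_mono)
qed

lemma eq_of_dvd_diff:
  assumes "int r dvd int a - int b" "\<bar>int a - int b\<bar> < int r"
  shows "a = b"
proof (rule ccontr)
  assume "a \<noteq> b"
  then have "int a - int b \<noteq> 0" by simp
  with assms(1) have "\<bar>int r\<bar> \<le> \<bar>int a - int b\<bar>" by (rule dvd_imp_le_int[rotated])
  with assms(2) show False by simp
qed

text \<open>Reduced fractions are determined by their value, and the numerators range over one period.\<close>
lemma frac_val_inj: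
  assumes "y \<in> sieve_fracs z R" "y' \<in> sieve_fracs z R" "frac_val y - frac_val y' \<in> \<int>"
  shows "y = y'"
proof -
  obtain r b r' b' where y: "y = (r, b)" "y' = (r', b')" by force
  have pos: "r > 0" "r' > 0" "b > 0" "b' > 0" "b \<le> r" "b' \<le> r'" and co: "coprime b r" "coprime b' r'"
    using assms(1,2) unfolding y by (auto simp: sieve_fracs_def in_totatives_iff dest: sieve_moduli_pos)
  have "frac_val y - frac_val y' = real_of_int (int b * int r' - int b' * int r) / real_of_int (int r * int r')"
    using pos by (simp add: y frac_val_def field_simps)
  with assms(3) have "int r * int r' dvd int b * int r' - int b' * int r"
    using pos by (intro divide_in_Ints_imp_dvd) auto
  then obtain k where k: "int b * int r' - int b' * int r = int r * int r' * k" by (elim dvdE)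
  have "int b * int r' = int r * (int r' * k + int b')" using k by (simp add: algebra_simps)
  then have "int r dvd int b * int r'" by simp
  then have 1: "r dvd r'" using co by (metis coprime_commute coprime_dvd_mult_right_iff int_dvd_int_iff of_nat_mult)
  have "int b' * int r = int r' * (int b - int r * k)" using k by (simp add: algebra_simps)
  then have "int r' dvd int b' * int r" by simp
  then have 2: "r' dvd r" using co by (metis coprime_commute coprime_dvd_mult_right_iff int_dvd_int_iff of_nat_mult)
  have r: "r = r'" using 1 2 by (simp add: dvd_antisym)
  have "int r * (int b - int b') = int r * (int r * k)" using k unfolding r by (simp add: algebra_simps)
  then have "int b - int b' = int r * k" using pos by simp
  then have "int r dvd int b - int b'" by simp
  moreover have "\<bar>int b - int b'\<bar> < int r" using pos r by auto
  ultimately have "b = b'" by (rule eq_of_dvd_diff)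
  then show ?thesis using r y by simp
qed

text \<open>Pairs whose differences lie, modulo 1, in a common window of length \<open>1/M\<close> form such a set once
  \<open>R^4 \<le> M\<close>.\<close>
definition constant_diff :: "((nat \<times> nat) \<times> (nat \<times> nat)) set \<Rightarrow> bool" where
  "constant_diff \<P> \<longleftrightarrow> (\<forall>P\<in>\<P>. \<forall>P'\<in>\<P>.
     (frac_val (fst P) - frac_val (snd P)) - (frac_val (fst P') - frac_val (snd P')) \<in> \<int>)"

lemma constant_diff_inj:
  assumes "constant_diff \<P>" "\<P> \<subseteq> sieve_fracs z R \<times> sieve_fracs z R"
  shows "inj_on fst \<P>" "inj_on snd \<P>"
proof -
  have *: "(frac_val (fst P) - frac_val (snd P)) - (frac_val (fst P') - frac_val (snd P')) \<in> \<int>"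
    if "P \<in> \<P>" "P' \<in> \<P>" for P P' using assms(1) that by (auto simp: constant_diff_def)
  show "inj_on fst \<P>"
  proof (rule inj_onI)
    fix P P' assume P: "P \<in> \<P>" "P' \<in> \<P>" "fst P = fst P'"
    then have "frac_val (snd P') - frac_val (snd P) \<in> \<int>" using *[OF P(1,2)] by simp
    then have "snd P' = snd P" using P assms(2) by (intro frac_val_inj) auto
    with P show "P = P'" by (simp add: prod_eq_iff)
  qed
  show "inj_on snd \<P>"
  proof (rule inj_onI)
    fix P P' assume P: "P \<in> \<P>" "P' \<in> \<P>" "snd P = snd P'"
    then have "frac_val (fst P) - frac_val (fst P') \<in> \<int>" using *[OF P(1,2)] by simp
    then have "fst P = fst P'" using P assms(2) by (intro frac_val_inj) auto
    with P show "P = P'" by (simp add: prod_eq_iff)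
  qed
qed

lemma constant_diff_subset: "constant_diff \<P> \<Longrightarrow> \<Q> \<subseteq> \<P> \<Longrightarrow> constant_diff \<Q>"
  by (auto simp: constant_diff_def)

lemma sum_wt_fst_square_le:
  assumes "constant_diff \<P>" "\<P> \<subseteq> sieve_fracs z R \<times> sieve_fracs z R"
  shows "(\<Sum>P\<in>\<P>. (frac_wt (fst P))\<^sup>2) \<le> sieve_mass z R"
proof -
  have "(\<Sum>P\<in>\<P>. (frac_wt (fst P))\<^sup>2) = (\<Sum>y\<in>fst ` \<P>. (frac_wt y)\<^sup>2)"
    using constant_diff_inj(1)[OF assms] by (simp add: sum.reindex)
  also have "\<dots> \<le> (\<Sum>y\<in>sieve_fracs z R. (frac_wt y)\<^sup>2)"
    using assms(2) by (intro sum_mono2) auto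
  finally show ?thesis by (simp add: sum_frac_wt_square)
qed

section \<open>Differences of sieve fractions\<close>

lemma dvd_of_dvd_multiple_diff:
  fixes a :: int
  assumes "a dvd x * a - y"
  shows "a dvd y"
proof -
  have "a dvd x * a - (x * a - y)" by (rule dvd_diff[OF _ assms]) simp
  then show ?thesis by simp
qed

lemma sum_wt_square_multiples_le:
  assumes "prime p"
  shows "(\<Sum>y | y \<in> sieve_fracs z R \<and> p dvd fst y. (frac_wt y)\<^sup>2) \<le> sieve_mass z R / real (p - 1)"
proof -
  let ?A = "{r. r \<in> sieve_moduli z R \<and> p dvd r}"
  have "{y. y \<in> sieve_fracs z R \<and> p dvd fst y} = (SIGMA r:?A. totatives r)"
    by (auto simp: sieve_fracs_def)
  then have "(\<Sum>y | y \<in> sieve_fracs z R \<and> p dvd fst y. (frac_wt y)\<^sup>2)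
      = (\<Sum>r\<in>?A. \<Sum>b\<in>totatives r. (1 / real (totient r))\<^sup>2)"
    by (subst sum.Sigma) (auto simp: frac_wt_def case_prod_unfold)
  also have "\<dots> = (\<Sum>r\<in>?A. 1 / real (totient r))"
    by (intro sum.cong refl) (auto simp: totient_def power2_eq_square dest: sieve_moduli_pos)
  finally show ?thesis using sieve_mass_multiples[OF assms] by simp
qed

text \<open>Clearing denominators in the integrality of the difference of differences leaves \<open>r\<close> dividing
  \<open>(b1 - b2) * r1 * r2\<close>.\<close>
lemma constant_diff_snd_cong:
  assumes cd: "constant_diff \<P>" and sub: "\<P> \<subseteq> sieve_fracs z R \<times> sieve_fracs z R" and p: "prime p"
    and in1: "((r1, a1), (r, b1)) \<in> \<P>" and in2: "((r2, a2), (r, b2)) \<in> \<P>"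
    and nd: "\<not> p dvd r1" "\<not> p dvd r2" and pd: "p dvd r"
  shows "int p dvd int b1 - int b2"
proof -
  have pos: "r1 > 0" "r2 > 0" "r > 0"
    using subsetD[OF sub in1] subsetD[OF sub in2] by (auto simp: sieve_fracs_def dest: sieve_moduli_pos)
  have "(real a1 / real r1 - real b1 / real r) - (real a2 / real r2 - real b2 / real r) \<in> \<int>"
    using bspec[OF bspec[OF cd[unfolded constant_diff_def] in1] in2] by (simp add: frac_val_def)
  also have "(real a1 / real r1 - real b1 / real r) - (real a2 / real r2 - real b2 / real r)
     = real_of_int ((int a1 * int r2 - int a2 * int r1) * int r - (int b1 - int b2) * (int r1 * int r2))
       / real_of_int (int r1 * int r2 * int r)"
    using pos by (simp add: field_simps)
  finally have "int r1 * int r2 * int r dvd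
      (int a1 * int r2 - int a2 * int r1) * int r - (int b1 - int b2) * (int r1 * int r2)"
    using pos by (intro divide_in_Ints_imp_dvd) auto
  then have "int r dvd (int a1 * int r2 - int a2 * int r1) * int r - (int b1 - int b2) * (int r1 * int r2)"
    by (rule dvd_mult_right)
  then have "int r dvd (int b1 - int b2) * (int r1 * int r2)"
    by (rule dvd_of_dvd_multiple_diff)
  then have "int p dvd (int b1 - int b2) * (int r1 * int r2)" using pd by (meson dvd_trans int_dvd_int_iff)
  moreover have "prime (int p)" using p by simp
  ultimately show ?thesis using nd by (simp add: prime_dvd_mult_iff)
qed

text \<open>The gain of a second factor \<open>1 / (p - 1)\<close>: the difference \<open>a/r\<^sub>1 - b/r\<close> being fixed modulo 1
  with \<open>p\<close> not dividing \<open>r\<^sub>1\<close>, the \<open>p\<close>-part of \<open>b/r\<close> is determined, so \<open>b\<close> is confined to one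
  class modulo \<open>p\<close> and takes at most \<open>\<phi>(r/p)\<close> values.\<close>
lemma sum_wt_snd_square_le:
  assumes cd: "constant_diff \<P>" and sub: "\<P> \<subseteq> sieve_fracs z R \<times> sieve_fracs z R" and p: "prime p"
    and nd: "\<And>P. P \<in> \<P> \<Longrightarrow> \<not> p dvd fst (fst P)" and pd: "\<And>P. P \<in> \<P> \<Longrightarrow> p dvd fst (snd P)"
  shows "(\<Sum>P\<in>\<P>. (frac_wt (snd P))\<^sup>2) \<le> sieve_mass z R / (real (p - 1))\<^sup>2"
proof -
  define A where "A = {r. r \<in> sieve_moduli z R \<and> p dvd r}"
  define C where "C r = {b. (r, b) \<in> snd ` \<P>}" for r
  have p1: "p > 1" using p by (rule prime_gt_1_nat)
  have finA: "finite A" by (auto simp: A_def)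
  have Ctot: "C r \<subseteq> totatives r" for r using sub by (auto simp: C_def sieve_fracs_def)
  have "snd ` \<P> = (SIGMA r:A. C r)"
  proof (intro set_eqI iffI)
    fix y assume y: "y \<in> snd ` \<P>"
    then obtain P where P: "P \<in> \<P>" "y = snd P" by blast
    then have "y \<in> sieve_fracs z R" "p dvd fst y" using subsetD[OF sub P(1)] pd by auto
    then show "y \<in> (SIGMA r:A. C r)" using y by (cases y) (simp add: A_def C_def sieve_fracs_def)
  qed (simp add: C_def split: prod.splits, force)
  moreover have "(\<Sum>P\<in>\<P>. (frac_wt (snd P))\<^sup>2) = (\<Sum>y\<in>snd ` \<P>. (frac_wt y)\<^sup>2)"
    using constant_diff_inj(2)[OF cd sub] by (simp add: sum.reindex)
  moreover have "(\<Sum>r\<in>A. \<Sum>b\<in>C r. (1 / real (totient r))\<^sup>2) = (\<Sum>y\<in>(SIGMA r:A. C r). (frac_wt y)\<^sup>2)"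
    using finA finite_subset[OF Ctot] by (subst sum.Sigma) (auto simp: frac_wt_def case_prod_unfold)
  ultimately have "(\<Sum>P\<in>\<P>. (frac_wt (snd P))\<^sup>2) = (\<Sum>r\<in>A. \<Sum>b\<in>C r. (1 / real (totient r))\<^sup>2)"
    by (simp only:)
  also have "\<dots> \<le> (\<Sum>r\<in>A. 1 / real (totient r) / real (p - 1))"
  proof (rule sum_mono)
    fix r assume r: "r \<in> A"
    then have "squarefree r" "p dvd r" by (auto simp: A_def sieve_moduli_def)
    then obtain s where s: "r = p * s" "coprime p s" "s > 0" "totient r = (p - 1) * totient s"
      using squarefree_prime_split[of r p] p by metis
    have "card (C r) \<le> card (totatives s)"
    proof (rule card_inj_on_le)
      show "inj_on (\<lambda>b. (b - 1) mod s + 1) (C r)"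
      proof (rule inj_onI)
        fix b1 b2 assume b: "b1 \<in> C r" "b2 \<in> C r" "(b1 - 1) mod s + 1 = (b2 - 1) mod s + 1"
        have le: "b1 > 0" "b2 > 0" "b1 \<le> r" "b2 \<le> r" using b(1,2) Ctot[of r] by (auto simp: in_totatives_iff)
        have "int (b1 - 1) mod int s = int (b2 - 1) mod int s" using b(3) by (simp flip: zmod_int)
        then have "int s dvd int (b1 - 1) - int (b2 - 1)" by (simp add: mod_eq_dvd_iff)
        then have "int s dvd int b1 - int b2" using le by (simp add: of_nat_diff)
        moreover have "int p dvd int b1 - int b2"
        proof -
          obtain y1 y2 where y: "(y1, (r, b1)) \<in> \<P>" "(y2, (r, b2)) \<in> \<P>"
            using b(1,2) by (auto simp: C_def)
          then show ?thesis
            using constant_diff_snd_cong[OF cd sub p, of "fst y1" "snd y1" r b1 "fst y2" "snd y2" b2]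
              nd[OF y(1)] nd[OF y(2)] \<open>p dvd r\<close> by simp
        qed
        moreover have "coprime (int p) (int s)" using s(2) by simp
        ultimately have "int p * int s dvd int b1 - int b2" by (intro divides_mult)
        then have "int r dvd int b1 - int b2" using s(1) by simp
        moreover have "\<bar>int b1 - int b2\<bar> < int r" using le by auto
        ultimately show "b1 = b2" by (rule eq_of_dvd_diff)
      qed
      show "(\<lambda>b. (b - 1) mod s + 1) ` C r \<subseteq> totatives s"
      proof
        fix c assume "c \<in> (\<lambda>b. (b - 1) mod s + 1) ` C r"
        then obtain b where b: "b \<in> C r" and c: "c = (b - 1) mod s + 1" by blast
        then have "b > 0" "coprime b r" using Ctot[of r] by (auto simp: in_totatives_iff)
        then show "c \<in> totatives s" unfolding c using s by (intro residue_in_totatives) auto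
      qed
    qed simp
    then have "(\<Sum>b\<in>C r. (1 / real (totient r))\<^sup>2) \<le> real (totient s) * (1 / real (totient r))\<^sup>2"
      by (simp add: totient_def mult_right_mono divide_right_mono)
    also have "\<dots> = 1 / real (totient r) / real (p - 1)"
    proof -
      have "real (totient s) \<noteq> 0" "real (p - 1) \<noteq> 0" using s p1 by auto
      then show ?thesis unfolding s(4) of_nat_mult power2_eq_square
        by (simp add: divide_simps del: of_nat_diff)
    qed
    finally show "(\<Sum>b\<in>C r. (1 / real (totient r))\<^sup>2) \<le> 1 / real (totient r) / real (p - 1)" .
  qed
  also have "\<dots> \<le> sieve_mass z R / real (p - 1) / real (p - 1)"
    unfolding sum_divide_distrib[symmetric] A_def
    by (intro divide_right_mono sieve_mass_multiples p) simp
  finally show ?thesis by (simp add: power2_eq_square)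
qed

text \<open>With \<open>L = sieve_mass z R\<close>, the squares of the first factor sum to at most \<open>L\<close>, those of the
  second to at most \<open>L / (p - 1)\<^sup>2\<close>, so the inequality between arithmetic and geometric means is
  applied with weights \<open>1 / (p - 1)\<close> and \<open>p - 1\<close>.\<close>
lemma sum_wt_prod_mixed_le:
  assumes cd: "constant_diff \<P>" and sub: "\<P> \<subseteq> sieve_fracs z R \<times> sieve_fracs z R" and p: "prime p"
    and nd: "\<And>P. P \<in> \<P> \<Longrightarrow> \<not> p dvd fst (fst P)" and pd: "\<And>P. P \<in> \<P> \<Longrightarrow> p dvd fst (snd P)"
  shows "(\<Sum>P\<in>\<P>. frac_wt (fst P) * frac_wt (snd P)) \<le> sieve_mass z R / real (p - 1)"
proof -
  define t where "t = real (p - 1)"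
  have t: "t > 0" using prime_gt_1_nat[OF p] by (simp add: t_def)
  have amgm: "x * y \<le> (x\<^sup>2 / t + t * y\<^sup>2) / 2" for x y :: real
  proof -
    have "0 \<le> (x - t * y)\<^sup>2 / t" using t by simp
    also have "\<dots> = x\<^sup>2 / t + t * y\<^sup>2 - 2 * (x * y)" using t by (simp add: power2_eq_square field_simps)
    finally show ?thesis by simp
  qed
  have "(\<Sum>P\<in>\<P>. frac_wt (fst P) * frac_wt (snd P))
      \<le> (\<Sum>P\<in>\<P>. ((frac_wt (fst P))\<^sup>2 / t + t * (frac_wt (snd P))\<^sup>2) / 2)"
    by (intro sum_mono amgm)
  also have "\<dots> = ((\<Sum>P\<in>\<P>. (frac_wt (fst P))\<^sup>2) / t + t * (\<Sum>P\<in>\<P>. (frac_wt (snd P))\<^sup>2)) / 2"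
    by (simp add: sum.distrib sum_distrib_left flip: sum_divide_distrib)
  also have "\<dots> \<le> (sieve_mass z R / t + t * (sieve_mass z R / t\<^sup>2)) / 2"
    using sum_wt_fst_square_le[OF cd sub] sum_wt_snd_square_le[OF assms] t
    unfolding t_def by (intro divide_right_mono add_mono mult_left_mono) auto
  also have "\<dots> = sieve_mass z R / t" using t by (simp add: power2_eq_square)
  finally show ?thesis by (simp add: t_def)
qed

text \<open>Here the squares of either factor already sum to at most the right-hand side, since \<open>p\<close> divides
  both denominators.\<close>
lemma sum_wt_prod_both_le:
  assumes cd: "constant_diff \<P>" and sub: "\<P> \<subseteq> sieve_fracs z R \<times> sieve_fracs z R" and p: "prime p"
    and pd: "\<And>P. P \<in> \<P> \<Longrightarrow> p dvd fst (fst P) \<and> p dvd fst (snd P)"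
  shows "(\<Sum>P\<in>\<P>. frac_wt (fst P) * frac_wt (snd P)) \<le> sieve_mass z R / real (p - 1)"
proof -
  let ?F = "{y. y \<in> sieve_fracs z R \<and> p dvd fst y}"
  have le: "(\<Sum>P\<in>\<P>. (frac_wt (f P))\<^sup>2) \<le> sieve_mass z R / real (p - 1)" if "inj_on f \<P>" "f ` \<P> \<subseteq> ?F" for f
  proof -
    have "(\<Sum>P\<in>\<P>. (frac_wt (f P))\<^sup>2) = (\<Sum>y\<in>f ` \<P>. (frac_wt y)\<^sup>2)" using that(1) by (simp add: sum.reindex)
    also have "\<dots> \<le> (\<Sum>y\<in>?F. (frac_wt y)\<^sup>2)" using that(2) by (intro sum_mono2) auto
    finally show ?thesis using sum_wt_square_multiples_le[OF p, of z R] by simp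
  qed
  have amgm: "x * y \<le> (x\<^sup>2 + y\<^sup>2) / 2" for x y :: real
    using sum_squares_bound[of x y] by simp
  have "(\<Sum>P\<in>\<P>. frac_wt (fst P) * frac_wt (snd P)) \<le> (\<Sum>P\<in>\<P>. ((frac_wt (fst P))\<^sup>2 + (frac_wt (snd P))\<^sup>2) / 2)"
    by (intro sum_mono amgm)
  also have "\<dots> = ((\<Sum>P\<in>\<P>. (frac_wt (fst P))\<^sup>2) + (\<Sum>P\<in>\<P>. (frac_wt (snd P))\<^sup>2)) / 2"
    by (simp add: sum.distrib flip: sum_divide_distrib)
  also have "\<dots> \<le> sieve_mass z R / real (p - 1)"
  proof -
    have avg: "a \<le> L \<Longrightarrow> b \<le> L \<Longrightarrow> (a + b) / 2 \<le> L" for a b L :: real by simp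
    have F: "fst ` \<P> \<subseteq> ?F" "snd ` \<P> \<subseteq> ?F" using sub pd by auto
    show ?thesis
      by (intro avg le constant_diff_inj[OF cd sub] F)
  qed
  finally show ?thesis .
qed

text \<open>Any prime factor of the reduced denominator \<open>q\<close> of the common difference works: \<open>q\<close> divides the
  product of the two denominators in every pair. That \<open>q \<noteq> 1\<close> is the assumption that the two
  fractions of some pair differ.\<close>
lemma constant_diff_prime:
  assumes cd: "constant_diff \<P>" and sub: "\<P> \<subseteq> sieve_fracs z R \<times> sieve_fracs z R"
    and P0: "P0 \<in> \<P>" "fst P0 \<noteq> snd P0"
  obtains p where "prime p" "z < p" "\<And>P. P \<in> \<P> \<Longrightarrow> p dvd fst (fst P) \<or> p dvd fst (snd P)"
proof -
  obtain r0 b0 r0' b0' where P0': "P0 = ((r0, b0), (r0', b0'))" by (metis surj_pair)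
  have R0: "r0 \<in> sieve_moduli z R" "r0' \<in> sieve_moduli z R"
    using P0(1) sub by (auto simp: P0' sieve_fracs_def)
  then have pos0: "r0 > 0" "r0' > 0" by (auto dest: sieve_moduli_pos)
  define m where "m = int r0 * int r0'"
  define d where "d = int b0 * int r0' - int b0' * int r0"
  have m: "m > 0" using pos0 by (simp add: m_def)
  have v0: "frac_val (fst P0) - frac_val (snd P0) = real_of_int d / real_of_int m"
    using pos0 by (simp add: P0' frac_val_def m_def d_def field_simps)
  define g where "g = gcd m d"
  have g: "g > 0" using m by (simp add: g_def)
  then have "gcd m d \<noteq> 0" by (simp add: g_def)
  then obtain q c where qc: "m = g * q" "d = g * c" "coprime q c"
    using gcd_coprime_exists[of m d] unfolding g_def by (auto simp: mult.commute)
  have q: "q > 0" using m g qc(1) by (simp add: zero_less_mult_iff)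
  have "q \<noteq> 1"
  proof
    assume "q = 1"
    then have "real_of_int d / real_of_int m = of_int c" using qc g by simp
    then have "frac_val (fst P0) - frac_val (snd P0) \<in> \<int>" using v0 by simp
    then have "fst P0 = snd P0" using P0(1) sub by (intro frac_val_inj) auto
    with P0(2) show False by simp
  qed
  with q have "nat q \<noteq> 1" by simp
  then obtain p where p: "prime p" "p dvd nat q" using prime_factor_nat by blast
  then have "int p dvd int (nat q)" by (simp only: int_dvd_int_iff)
  then have pq: "int p dvd q" using q by simp
  have pdv: "p dvd r \<or> p dvd r'" if "q dvd int r * int r'" for r r'
  proof -
    have "int p dvd int (r * r')" using that pq by (simp add: dvd_trans)
    then show ?thesis using p(1) by (simp only: int_dvd_int_iff prime_dvd_mult_iff)
  qed
  have "p dvd r0 \<or> p dvd r0'" using pdv qc(1) by (metis dvd_triv_right m_def)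
  then have "z < p" using R0 p(1) by (auto simp: sieve_moduli_def)
  moreover have "p dvd fst (fst P) \<or> p dvd fst (snd P)" if P: "P \<in> \<P>" for P
  proof -
    obtain r b r' b' where P': "P = ((r, b), (r', b'))" by (metis surj_pair)
    have pos: "r > 0" "r' > 0" using subsetD[OF sub P] by (auto simp: P' sieve_fracs_def dest: sieve_moduli_pos)
    have "(frac_val (fst P) - frac_val (snd P)) - (frac_val (fst P0) - frac_val (snd P0)) \<in> \<int>"
      using cd P P0(1) by (auto simp: constant_diff_def)
    also have "(frac_val (fst P) - frac_val (snd P)) - (frac_val (fst P0) - frac_val (snd P0))
       = real_of_int ((int b * int r' - int b' * int r) * q - c * (int r * int r')) / real_of_int (int r * int r' * q)"
    proof -
      have dm: "real_of_int d / real_of_int m = real_of_int c / real_of_int q" using qc g by simp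
      show ?thesis unfolding v0 dm using pos q by (simp add: P' frac_val_def field_simps)
    qed
    finally have "int r * int r' * q dvd (int b * int r' - int b' * int r) * q - c * (int r * int r')"
      using pos q by (intro divide_in_Ints_imp_dvd) auto
    then have "q dvd (int b * int r' - int b' * int r) * q - c * (int r * int r')" by (rule dvd_mult_right)
    then have "q dvd c * (int r * int r')"
      by (rule dvd_of_dvd_multiple_diff)
    then have "q dvd int r * int r'" using qc(3) by (simp add: coprime_dvd_mult_right_iff)
    then show ?thesis using pdv by (simp add: P')
  qed
  ultimately show ?thesis using that p(1) by blast
qed

text \<open>With \<open>p\<close> from \<open>constant_diff_prime\<close>, the pairs fall into three classes according to which of the
  two denominators \<open>p\<close> divides, and each class contributes at most \<open>sieve_mass z R / (p - 1)\<close>.\<close>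
lemma sum_wt_prod_le:
  assumes cd: "constant_diff \<P>" and sub: "\<P> \<subseteq> sieve_fracs z R \<times> sieve_fracs z R"
    and ne: "\<And>P. P \<in> \<P> \<Longrightarrow> fst P \<noteq> snd P" and z: "z > 0"
  shows "(\<Sum>P\<in>\<P>. frac_wt (fst P) * frac_wt (snd P)) \<le> 3 * sieve_mass z R / real z"
proof (cases "\<P> = {}")
  case True
  then show ?thesis using sieve_mass_nonneg by simp
next
  case False
  then obtain P0 where P0: "P0 \<in> \<P>" by blast
  obtain p where p: "prime p" "z < p" "\<And>P. P \<in> \<P> \<Longrightarrow> p dvd fst (fst P) \<or> p dvd fst (snd P)"
    using constant_diff_prime[OF cd sub P0 ne[OF P0]] by blast
  let ?w = "\<lambda>P. frac_wt (fst P) * frac_wt (snd P)"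
  define A where "A = {P \<in> \<P>. \<not> p dvd fst (fst P)}"
  define B where "B = {P \<in> \<P>. \<not> p dvd fst (snd P)}"
  define C where "C = {P \<in> \<P>. p dvd fst (fst P) \<and> p dvd fst (snd P)}"
  define L where "L = sieve_mass z R / real (p - 1)"
  have fin: "finite \<P>" using sub by (rule finite_subset) auto
  have "\<P> = A \<union> (B \<union> C)" "A \<inter> (B \<union> C) = {}" "B \<inter> C = {}"
    using p(3) by (auto simp: A_def B_def C_def)
  moreover have "finite A" "finite B" "finite C" using fin by (auto simp: A_def B_def C_def)
  ultimately have "sum ?w \<P> = sum ?w A + (sum ?w B + sum ?w C)" by (simp add: sum.union_disjoint)
  moreover have "sum ?w A \<le> L" unfolding L_def using p(3) sub
    by (intro sum_wt_prod_mixed_le[OF constant_diff_subset[OF cd] _ p(1)]) (auto simp: A_def)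
  moreover have "sum ?w C \<le> L" unfolding L_def using sub
    by (intro sum_wt_prod_both_le[OF constant_diff_subset[OF cd] _ p(1)]) (auto simp: C_def)
  moreover have "sum ?w B \<le> L"
  proof -
    have "sum ?w B = sum ?w (prod.swap ` B)"
      by (subst sum.reindex) (auto simp: mult.commute)
    moreover have "constant_diff (prod.swap ` B)"
      unfolding constant_diff_def
    proof (safe, simp only: fst_conv snd_conv prod.swap_def)
      fix y y' x x' assume "(y, y') \<in> B" "(x, x') \<in> B"
      then have "(frac_val x - frac_val x') - (frac_val y - frac_val y') \<in> \<int>"
        using cd by (force simp: constant_diff_def B_def)
      then show "(frac_val y' - frac_val y) - (frac_val x' - frac_val x) \<in> \<int>" by (simp add: algebra_simps)
    qed
    moreover have "prod.swap ` B \<subseteq> sieve_fracs z R \<times> sieve_fracs z R" using sub by (auto simp: B_def)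
    moreover have "\<not> p dvd fst (fst P)" "p dvd fst (snd P)" if "P \<in> prod.swap ` B" for P
    proof -
      obtain Q where Q: "Q \<in> B" "P = prod.swap Q" using \<open>P \<in> prod.swap ` B\<close> by blast
      then have "Q \<in> \<P>" "\<not> p dvd fst (snd Q)" by (auto simp: B_def)
      then show "\<not> p dvd fst (fst P)" "p dvd fst (snd P)" using p(3)[of Q] Q(2) by auto
    qed
    ultimately show ?thesis unfolding L_def using sum_wt_prod_mixed_le[OF _ _ p(1), of "prod.swap ` B" z R] by simp
  qed
  ultimately have "sum ?w \<P> \<le> 3 * L" by linarith
  also have "\<dots> \<le> 3 * sieve_mass z R / real z"
    unfolding L_def using p(2) z sieve_mass_nonneg[of z R] by (simp add: frac_le)
  finally show ?thesis .
qed

section \<open>The sieved dual large sieve\<close>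

lemma real_eq_0_of_small_denominator:
  fixes x :: real
  assumes "x * real d \<in> \<int>" "\<bar>x\<bar> < 1 / real M" "0 < d" "d \<le> M"
  shows "x = 0"
proof -
  obtain k where k: "x * real d = of_int k" using assms(1) by (auto elim: Ints_cases)
  have "\<bar>x\<bar> * real d < 1 / real M * real d" using assms by (intro mult_strict_right_mono) auto
  also have "\<dots> \<le> 1" using assms by simp
  finally have "\<bar>of_int k :: real\<bar> < 1" using k by (simp add: abs_mult flip: k)
  then have "k = 0" by linarith
  then show ?thesis using k assms by simp
qed

text \<open>A difference of two differences of sieve fractions has denominator at most \<open>R^4\<close>; being less
  than \<open>1/M\<close> from an integer, it is an integer.\<close>
lemma cluster_constant_diff:
  assumes "R ^ 4 \<le> M" and sub: "S \<subseteq> sieve_fracs z R \<times> sieve_fracs z R"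
    and cl: "\<And>P. P \<in> S \<Longrightarrow> t \<le> \<theta> + (frac_val (fst P) - frac_val (snd P)) + of_int (k P)
                       \<and> \<theta> + (frac_val (fst P) - frac_val (snd P)) + of_int (k P) < t + 1 / real M"
  shows "constant_diff S"
  unfolding constant_diff_def
proof (intro ballI)
  fix P P' assume P: "P \<in> S" "P' \<in> S"
  define x where "x = (frac_val (fst P) - frac_val (snd P)) - (frac_val (fst P') - frac_val (snd P'))
                        + of_int (k P - k P')"
  define d where "d = (fst (fst P) * fst (snd P)) * (fst (fst P') * fst (snd P'))"
  have mem: "fst (fst P) \<in> sieve_moduli z R" "fst (snd P) \<in> sieve_moduli z R"
    "fst (fst P') \<in> sieve_moduli z R" "fst (snd P') \<in> sieve_moduli z R"
    using subsetD[OF sub P(1)] subsetD[OF sub P(2)] by (auto simp: sieve_fracs_def)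
  note pos = mem[THEN sieve_moduli_pos]
  have "d \<le> (R * R) * (R * R)" unfolding d_def using mem
    by (intro mult_le_mono) (auto simp: sieve_moduli_def)
  then have "d \<le> M" using assms(1) by (simp add: power4_eq_xxxx mult.assoc)
  moreover have "d > 0" using pos by (simp add: d_def)
  moreover have "\<bar>x\<bar> < 1 / real M" using cl[OF P(1)] cl[OF P(2)] unfolding x_def by (simp add: abs_if)
  moreover have "x * real d \<in> \<int>"
  proof -
    obtain r1 a1 r2 a2 where 1: "P = ((r1, a1), (r2, a2))" by (metis surj_pair)
    obtain r3 a3 r4 a4 where 2: "P' = ((r3, a3), (r4, a4))" by (metis surj_pair)
    have "r1 > 0" "r2 > 0" "r3 > 0" "r4 > 0" using pos 1 2 by auto
    then have "x * real d = real a1 * real r2 * real r3 * real r4 - real a2 * real r1 * real r3 * real r4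
       - real a3 * real r4 * real r1 * real r2 + real a4 * real r3 * real r1 * real r2
       + of_int (k P - k P') * (real r1 * real r2 * real r3 * real r4)"
      unfolding x_def d_def 1 2 frac_val_def by (simp add: field_simps)
    then show ?thesis by simp
  qed
  ultimately have "x = 0" by (intro real_eq_0_of_small_denominator[of x d M])
  then have "(frac_val (fst P) - frac_val (snd P)) - (frac_val (fst P') - frac_val (snd P')) = of_int (k P' - k P)"
    by (simp add: x_def)
  then show "(frac_val (fst P) - frac_val (snd P)) - (frac_val (fst P') - frac_val (snd P')) \<in> \<int>"
    by (simp only: Ints_of_int)
qed

lemma off_diagonal_fejer_le:
  assumes "R ^ 4 \<le> M" "M > 0" "z > 0"
  shows "(\<Sum>P | P \<in> sieve_fracs z R \<times> sieve_fracs z R \<and> fst P \<noteq> snd P.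
            frac_wt (fst P) * frac_wt (snd P) * fejer M (\<theta> + (frac_val (fst P) - frac_val (snd P))))
         \<le> 17/6 * (real M)\<^sup>2 * (3 * sieve_mass z R / real z)"
proof (rule cluster_bound)
  show "finite {P \<in> sieve_fracs z R \<times> sieve_fracs z R. fst P \<noteq> snd P}" by simp
  fix S t k
  assume S: "S \<subseteq> {P \<in> sieve_fracs z R \<times> sieve_fracs z R. fst P \<noteq> snd P}"
    and cl: "\<And>P. P \<in> S \<Longrightarrow> t \<le> \<theta> + (frac_val (fst P) - frac_val (snd P)) + real_of_int (k P) \<and>
           \<theta> + (frac_val (fst P) - frac_val (snd P)) + real_of_int (k P) < t + 1 / real M"
  have sub: "S \<subseteq> sieve_fracs z R \<times> sieve_fracs z R" using S by auto
  have "constant_diff S" by (rule cluster_constant_diff[OF assms(1) sub cl])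
  then show "(\<Sum>P\<in>S. frac_wt (fst P) * frac_wt (snd P)) \<le> 3 * sieve_mass z R / real z"
    using S by (intro sum_wt_prod_le sub assms(3)) auto
qed (use assms in \<open>auto intro: mult_nonneg_nonneg frac_wt_nonneg\<close>)

text \<open>Schur's test; \<open>x i * x j\<close> is bounded by the mean of the squares.\<close>
lemma schur_bound:
  fixes K :: "'a \<Rightarrow> 'a \<Rightarrow> real" and x :: "'a \<Rightarrow> real"
  assumes "\<And>i. i \<in> I \<Longrightarrow> (\<Sum>j\<in>I. K i j) \<le> C" "\<And>j. j \<in> I \<Longrightarrow> (\<Sum>i\<in>I. K i j) \<le> C"
    and "\<And>i j. K i j \<ge> 0"
  shows "(\<Sum>i\<in>I. \<Sum>j\<in>I. x i * x j * K i j) \<le> C * (\<Sum>i\<in>I. (x i)\<^sup>2)"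
proof -
  have "(\<Sum>i\<in>I. \<Sum>j\<in>I. x i * x j * K i j) \<le> (\<Sum>i\<in>I. \<Sum>j\<in>I. ((x i)\<^sup>2 * K i j + (x j)\<^sup>2 * K i j) / 2)"
  proof (intro sum_mono)
    fix i j
    have "x i * x j \<le> ((x i)\<^sup>2 + (x j)\<^sup>2) / 2" using sum_squares_bound[of "x i" "x j"] by simp
    then have "x i * x j * K i j \<le> ((x i)\<^sup>2 + (x j)\<^sup>2) / 2 * K i j" by (intro mult_right_mono assms)
    then show "x i * x j * K i j \<le> ((x i)\<^sup>2 * K i j + (x j)\<^sup>2 * K i j) / 2" by (simp add: algebra_simps)
  qed
  also have "\<dots> = ((\<Sum>i\<in>I. \<Sum>j\<in>I. (x i)\<^sup>2 * K i j) + (\<Sum>i\<in>I. \<Sum>j\<in>I. (x j)\<^sup>2 * K i j)) / 2"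
    by (simp add: sum.distrib flip: sum_divide_distrib)
  also have "(\<Sum>i\<in>I. \<Sum>j\<in>I. (x j)\<^sup>2 * K i j) = (\<Sum>j\<in>I. \<Sum>i\<in>I. (x j)\<^sup>2 * K i j)"
    by (rule sum.swap)
  also have "(\<Sum>i\<in>I. \<Sum>j\<in>I. (x i)\<^sup>2 * K i j) \<le> (\<Sum>i\<in>I. (x i)\<^sup>2 * C)"
    unfolding sum_distrib_left[symmetric] by (intro sum_mono mult_left_mono assms(1)) auto
  also have "(\<Sum>j\<in>I. \<Sum>i\<in>I. (x j)\<^sup>2 * K i j) \<le> (\<Sum>j\<in>I. (x j)\<^sup>2 * C)"
    unfolding sum_distrib_left[symmetric] by (intro sum_mono mult_left_mono assms(2)) auto
  finally show ?thesis by (simp add: mult.commute flip: sum_distrib_left)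
qed

lemma fejer_minus: "fejer M (- x) = fejer M x"
proof -
  have "(\<Sum>h<M. e (real h * (- x))) = cnj (\<Sum>h<M. e (real h * x))"
    unfolding cnj_sum using e_diff[of 0] by (intro sum.cong) auto
  then show ?thesis by (simp add: fejer_def del: cnj_sum)
qed

lemma fejer_diff_commute: "fejer M (x - y) = fejer M (y - x)"
  using fejer_minus[of M "y - x"] by simp

lemma sum_Times: "(\<Sum>x\<in>A \<times> B. f x) = (\<Sum>a\<in>A. \<Sum>b\<in>B. f (a, b))"
  by (simp add: sum.cartesian_product)

text \<open>The bound of order \<open>M * (m + card I / z) / L\<close> for the primes in \<open>(R, M]\<close>, where \<open>m\<close> bounds the
  number of points in a window of length \<open>1/M\<close>. The diagonal pairs of fractions account for \<open>m\<close>,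
  the others for \<open>3 * card I / z\<close>.\<close>
lemma sieved_dual_large_sieve:
  fixes \<alpha> :: "'i \<Rightarrow> real" and b :: "'i \<Rightarrow> complex"
  assumes RM: "R ^ 4 \<le> M" "M > 0" "R \<ge> 1" "z > 0" and I: "finite I"
    and cl: "\<And>S t k. S \<subseteq> I \<Longrightarrow> (\<And>i. i \<in> S \<Longrightarrow> t \<le> \<alpha> i + of_int (k i) \<and> \<alpha> i + of_int (k i) < t + 1 / real M)
               \<Longrightarrow> card S \<le> m"
  shows "sieve_mass z R * (\<Sum>p | prime p \<and> R < p \<and> p \<le> M. (norm (\<Sum>i\<in>I. b i * e (\<alpha> i * real p)))\<^sup>2)
           \<le> 17/3 * real M * (real m + 3 * real (card I) / real z) * (\<Sum>i\<in>I. (norm (b i))\<^sup>2)"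
proof -
  define F where "F = sieve_fracs z R"
  define L where "L = sieve_mass z R"
  define T where "T n = (\<Sum>i\<in>I. b i * e (\<alpha> i * real n))" for n :: nat
  define c where "c y = (- 1) ^ card (prime_factors (fst y)) * complex_of_real (frac_wt y)" for y :: "nat \<times> nat"
  define K where "K n = (\<Sum>y\<in>F. c y * e (frac_val y * real n))" for n :: nat
  define \<theta> where "\<theta> x = \<alpha> (fst x) + frac_val (snd x)" for x :: "'i \<times> nat \<times> nat"
  define w where "w x = b (fst x) * c (snd x)" for x :: "'i \<times> nat \<times> nat"
  define B where "B = (\<Sum>i\<in>I. (norm (b i))\<^sup>2)"
  define \<kappa> where "\<kappa> = 17/6 * (real M)\<^sup>2"
  have L1: "L \<ge> 1" unfolding L_def using RM by (intro sieve_mass_ge_1)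
  have finF: "finite F" by (simp add: F_def)
  have B0: "B \<ge> 0" by (simp add: B_def sum_nonneg)
  have normc: "norm (c y) = frac_wt y" for y
    by (simp add: c_def norm_mult norm_power frac_wt_nonneg)
  have normw: "norm (w (i, y)) = norm (b i) * frac_wt y" for i y
    by (simp add: w_def norm_mult normc)
  have KT: "K n * T n = (\<Sum>x\<in>I \<times> F. w x * e (\<theta> x * real n))" for n
  proof -
    have "K n * T n = T n * K n" by (rule mult.commute)
    also have "\<dots> = (\<Sum>x\<in>I \<times> F. (b (fst x) * e (\<alpha> (fst x) * real n)) * (c (snd x) * e (frac_val (snd x) * real n)))"
      unfolding K_def T_def sum_product sum.cartesian_product by (simp only: case_prod_unfold)
    also have "\<dots> = (\<Sum>x\<in>I \<times> F. w x * e (\<theta> x * real n))"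
      by (intro sum.cong refl) (simp add: w_def \<theta>_def e_add distrib_right)
    finally show ?thesis .
  qed
  have Kp: "K p = of_real L" if "prime p" "R < p" for p
  proof -
    have "K p = (\<Sum>r\<in>sieve_moduli z R. \<Sum>a\<in>totatives r. c (r, a) * e (frac_val (r, a) * real p))"
      unfolding K_def F_def sieve_fracs_def by (subst sum.Sigma) auto
    also have "\<dots> = (\<Sum>r\<in>sieve_moduli z R. c (r, 1) * ramanujan_sum r p)"
      by (simp add: ramanujan_sum_def c_def frac_wt_def frac_val_def sum_distrib_left)
    also have "\<dots> = (\<Sum>r\<in>sieve_moduli z R. of_real (1 / real (totient r)))"
    proof (intro sum.cong refl)
      fix r assume r: "r \<in> sieve_moduli z R"
      then have "r > 0" "r < p" using that sieve_moduli_pos[OF r] by (auto simp: sieve_moduli_def)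
      then have "coprime p r" using that(1) by (metis nat_dvd_not_less prime_imp_coprime)
      then have "ramanujan_sum r p = (- 1) ^ card (prime_factors r)"
        using r by (intro ramanujan_sum_coprime) (auto simp: sieve_moduli_def)
      then show "c (r, 1) * ramanujan_sum r p = of_real (1 / real (totient r))"
        by (simp add: c_def frac_wt_def flip: power_mult_distrib)
    qed
    finally show ?thesis by (simp add: L_def sieve_mass_def)
  qed
  have diag: "(\<Sum>j\<in>I. fejer M (\<alpha> i - \<alpha> j)) \<le> \<kappa> * real m" for i
  proof -
    have "(\<Sum>j\<in>I. 1 * fejer M (\<alpha> j - \<alpha> i)) \<le> 17/6 * (real M)\<^sup>2 * real m"
    proof (rule cluster_bound[OF I RM(2)])
      fix S t k assume "S \<subseteq> I" and "\<And>j. j \<in> S \<Longrightarrow> t \<le> \<alpha> j - \<alpha> i + of_int (k j) \<and> \<alpha> j - \<alpha> i + of_int (k j) < t + 1 / real M"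
      then have "card S \<le> m" by (intro cl[of S "t + \<alpha> i" k]) (auto simp: algebra_simps)
      then show "(\<Sum>j\<in>S. 1) \<le> real m" by simp
    qed simp
    then show ?thesis by (simp add: \<kappa>_def fejer_diff_commute[of M "\<alpha> i"])
  qed
  \<comment> \<open>The bound for the sum over all pairs of sieve fractions, for fixed \<open>i\<close> and \<open>j\<close>: the diagonal and the off-diagonal part.\<close>
  define H where "H i j = L * fejer M (\<alpha> i - \<alpha> j) + \<kappa> * (3 * L / real z)" for i j
  have H: "(\<Sum>P\<in>F \<times> F. frac_wt (fst P) * frac_wt (snd P) * fejer M ((\<alpha> i - \<alpha> j) + (frac_val (fst P) - frac_val (snd P)))) \<le> H i j"
    (is "sum ?h _ \<le> _") for i j
  proof -
    let ?D = "{P \<in> F \<times> F. fst P = snd P}" and ?E = "{P \<in> F \<times> F. fst P \<noteq> snd P}"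
    have "sum ?h (F \<times> F) = sum ?h (?D \<union> ?E)" by (rule arg_cong[where f = "sum ?h"]) auto
    also have "\<dots> = sum ?h ?D + sum ?h ?E" using finF by (intro sum.union_disjoint) auto
    also have "sum ?h ?E \<le> \<kappa> * (3 * L / real z)"
      unfolding \<kappa>_def L_def F_def by (rule off_diagonal_fejer_le[OF RM(1,2,4)])
    also have "?D = (\<lambda>y. (y, y)) ` F" by auto
    also have "sum ?h \<dots> = (\<Sum>y\<in>F. (frac_wt y)\<^sup>2 * fejer M (\<alpha> i - \<alpha> j))"
      by (subst sum.reindex) (auto simp: inj_on_def power2_eq_square)
    also have "\<dots> = L * fejer M (\<alpha> i - \<alpha> j)"
      by (simp add: F_def L_def sum_frac_wt_square flip: sum_distrib_right)
    finally show ?thesis by (simp add: H_def)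
  qed
  have H0: "H i j \<ge> 0" for i j using L1 by (simp add: H_def \<kappa>_def fejer_nonneg)
  define C where "C = \<kappa> * L * (real m + 3 * real (card I) / real z)"
  have rowsum: "(\<Sum>j\<in>I. H i j) \<le> C" for i
  proof -
    have "(\<Sum>j\<in>I. H i j) = L * (\<Sum>j\<in>I. fejer M (\<alpha> i - \<alpha> j)) + real (card I) * (\<kappa> * (3 * L / real z))"
      by (simp add: H_def sum.distrib sum_distrib_left)
    also have "\<dots> \<le> L * (\<kappa> * real m) + real (card I) * (\<kappa> * (3 * L / real z))"
      using diag[of i] L1 by (intro add_right_mono mult_left_mono) auto
    also have "\<dots> = C" by (simp add: C_def algebra_simps)
    finally show ?thesis .
  qed
  have Hsym: "H i j = H j i" for i j by (simp add: H_def fejer_diff_commute[of M "\<alpha> i"])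
  have "(\<Sum>x\<in>I \<times> F. \<Sum>x'\<in>I \<times> F. norm (w x) * norm (w x') * fejer M (\<theta> x - \<theta> x'))
      = (\<Sum>i\<in>I. \<Sum>y\<in>F. \<Sum>j\<in>I. \<Sum>y'\<in>F. norm (w (i, y)) * norm (w (j, y')) * fejer M (\<theta> (i, y) - \<theta> (j, y')))"
    by (simp only: sum_Times)
  also have "\<dots> = (\<Sum>i\<in>I. \<Sum>j\<in>I. \<Sum>y\<in>F. \<Sum>y'\<in>F. norm (w (i, y)) * norm (w (j, y')) * fejer M (\<theta> (i, y) - \<theta> (j, y')))"
    by (rule sum.cong[OF refl], rule sum.swap)
  also have "\<dots> = (\<Sum>i\<in>I. \<Sum>j\<in>I. norm (b i) * norm (b j) *
      (\<Sum>P\<in>F \<times> F. frac_wt (fst P) * frac_wt (snd P) * fejer M ((\<alpha> i - \<alpha> j) + (frac_val (fst P) - frac_val (snd P)))))"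
    unfolding sum_Times sum_distrib_left
    by (intro sum.cong refl) (simp add: normw \<theta>_def algebra_simps)
  also have "\<dots> \<le> (\<Sum>i\<in>I. \<Sum>j\<in>I. norm (b i) * norm (b j) * H i j)"
    by (intro sum_mono mult_left_mono H) auto
  also have "\<dots> \<le> C * B"
    unfolding B_def
  proof (rule schur_bound)
    show "(\<Sum>i\<in>I. H i j) \<le> C" for j using rowsum[of j] by (simp only: Hsym[of _ j])
  qed (use rowsum H0 in auto)
  finally have main: "(\<Sum>x\<in>I \<times> F. \<Sum>x'\<in>I \<times> F. norm (w x) * norm (w x') * fejer M (\<theta> x - \<theta> x')) \<le> C * B" .
  let ?P = "{p. prime p \<and> R < p \<and> p \<le> M}"
  have "L * (L * (\<Sum>p\<in>?P. (norm (T p))\<^sup>2)) = (\<Sum>p\<in>?P. (norm (K p * T p))\<^sup>2)"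
    unfolding sum_distrib_left using L1
    by (intro sum.cong refl) (auto simp: Kp norm_mult power_mult_distrib power2_eq_square)
  also have "\<dots> \<le> (\<Sum>n=1..M. (norm (K n * T n))\<^sup>2)"
    by (intro sum_mono2) (auto dest: prime_gt_0_nat)
  finally have "real M * (L * (L * (\<Sum>p\<in>?P. (norm (T p))\<^sup>2))) \<le> real M * (\<Sum>n=1..M. (norm (K n * T n))\<^sup>2)"
    by (intro mult_left_mono) auto
  also have "\<dots> \<le> 2 * (C * B)"
    using weighted_mean_square_le_fejer[of M w \<theta> "I \<times> F"] main unfolding KT by linarith
  also have "\<dots> = real M * (L * (17/3 * real M * (real m + 3 * real (card I) / real z) * B))"
    by (simp add: C_def \<kappa>_def power2_eq_square)
  finally have "real M * (L * (L * (\<Sum>p\<in>?P. (norm (T p))\<^sup>2))) \<le>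
      real M * (L * (17/3 * real M * (real m + 3 * real (card I) / real z) * B))" .
  then have "L * (\<Sum>p\<in>?P. (norm (T p))\<^sup>2) \<le> 17/3 * real M * (real m + 3 * real (card I) / real z) * B"
    using RM(2) L1 by (simp add: mult_le_cancel_left_pos)
  then show ?thesis by (simp add: L_def T_def B_def)
qed

section \<open>Chebyshev and Mertens bounds\<close>

lemma prod_primes_dvd:
  fixes f :: "nat \<Rightarrow> nat"
  assumes "finite A" "\<And>p. p \<in> A \<Longrightarrow> prime p" "\<And>p. p \<in> A \<Longrightarrow> p ^ f p dvd n"
  shows "(\<Prod>p\<in>A. p ^ f p) dvd n"
  using assms
proof (induction A rule: finite_induct)
  case (insert p A)
  have "coprime (p ^ f p) (\<Prod>q\<in>A. q ^ f q)"
  proof (rule prod_coprime_right)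
    fix q assume "q \<in> A"
    then have "coprime p q" using insert by (intro primes_coprime) auto
    then show "coprime (p ^ f p) (q ^ f q)" by simp
  qed
  then show ?case using insert by (simp add: divides_mult)
qed simp

definition primorial :: "nat \<Rightarrow> nat" where
  "primorial n = \<Prod>{p. prime p \<and> p \<le> n}"

lemma finite_primes_le [simp]: "finite {p::nat. prime p \<and> p \<le> n}"
  by (rule finite_subset[of _ "{..n}"]) auto

text \<open>The two central coefficients in row \<open>2 * m + 1\<close> are equal and together at most the row sum.\<close>
lemma odd_central_binomial_le: "(2 * m + 1) choose m \<le> 4 ^ m"
proof -
  have "((2 * m + 1) choose m) + ((2 * m + 1) choose (m + 1)) = (\<Sum>k\<in>{m, m + 1}. (2 * m + 1) choose k)"
    by simp
  also have "\<dots> \<le> (\<Sum>k\<le>2 * m + 1. (2 * m + 1) choose k)" by (intro sum_mono2) auto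
  also have "\<dots> = 2 ^ (2 * m + 1)" by (rule choose_row_sum)
  also have "\<dots> = 2 * 4 ^ m" by (simp add: power_mult)
  finally show ?thesis using binomial_symmetric[of m "2 * m + 1"] by simp
qed

text \<open>The primes in \<open>(m + 1, 2 * m + 1]\<close> divide the central binomial coefficient, which is at most
  \<open>4^m\<close>.\<close>
lemma primorial_le: "primorial n \<le> 4 ^ n"
proof (induction n rule: less_induct)
  case (less n)
  consider "n \<le> 2" | "n > 2" "even n" | m where "n = 2 * m + 1" "m > 0"
  proof (cases "even n")
    case False
    then obtain m where "n = 2 * m + 1" by (elim oddE)
    then show ?thesis using that(1,3) by (cases "m = 0") auto
  qed (use that(1,2) in force)
  then show ?case
  proof cases
    case 1
    then have "{p::nat. prime p \<and> p \<le> n} = (if n = 2 then {2} else {})"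
      using prime_ge_2_nat by (auto dest!: prime_ge_2_nat)
    then show ?thesis by (auto simp: primorial_def)
  next
    case 2
    then have "\<not> prime n" using prime_odd_nat[of n] by auto
    then have "{p. prime p \<and> p \<le> n} = {p. prime p \<and> p \<le> n - 1}"
      using le_eq_less_or_eq by (auto simp: less_imp_le_nat)
    then have "primorial n = primorial (n - 1)" by (simp add: primorial_def)
    also have "\<dots> \<le> 4 ^ (n - 1)" using 2 by (intro less) auto
    also have "\<dots> \<le> 4 ^ n" by (intro power_increasing) auto
    finally show ?thesis .
  next
    case (3 m)
    let ?B = "{p. prime p \<and> m + 1 < p \<and> p \<le> n}"
    have "{p. prime p \<and> p \<le> n} = {p. prime p \<and> p \<le> m + 1} \<union> ?B" using 3 by auto
    moreover have "finite ?B" by (rule finite_subset[of _ "{..n}"]) auto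
    ultimately have "primorial n = primorial (m + 1) * \<Prod>?B"
      unfolding primorial_def by (simp add: prod.union_disjoint[symmetric] Int_def)
    also have "\<Prod>?B \<le> (2 * m + 1) choose m"
    proof (rule dvd_imp_le)
      have "(\<Prod>p\<in>?B. p ^ 1) dvd ((2 * m + 1) choose m)"
      proof (rule prod_primes_dvd)
        fix p assume p: "p \<in> ?B"
        have "fact m * fact (m + 1) * ((2 * m + 1) choose m) = (fact (2 * m + 1) :: nat)"
          using binomial_fact_lemma[of m "2 * m + 1"] by simp
        moreover have "p dvd fact (2 * m + 1)" using p 3 by (simp add: prime_dvd_fact_iff del: fact_Suc)
        ultimately have "p dvd fact m * fact (m + 1) * ((2 * m + 1) choose m)" by simp
        moreover have "\<not> p dvd fact m" "\<not> p dvd fact (m + 1)" using p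
          by (simp_all add: prime_dvd_fact_iff del: fact_Suc)
        ultimately show "p ^ 1 dvd ((2 * m + 1) choose m)" using p by (simp add: prime_dvd_mult_iff del: fact_Suc)
      qed (use \<open>finite ?B\<close> in auto)
      then show "\<Prod>?B dvd ((2 * m + 1) choose m)" by simp
    qed simp
    also have "(2 * m + 1) choose m \<le> 4 ^ m" by (rule odd_central_binomial_le)
    also have "primorial (m + 1) \<le> 4 ^ (m + 1)" using 3 by (intro less) auto
    finally have "primorial n \<le> 4 ^ (m + 1) * 4 ^ m" by simp
    also have "\<dots> = 4 ^ (m + 1 + m)" by (rule power_add[symmetric])
    finally show ?thesis using 3 by (simp add: mult_2)
  qed
qed

lemma chebyshev_theta_le: "(\<Sum>p | prime p \<and> p \<le> n. ln (real p)) \<le> real n * ln 4"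
proof -
  have pos: "real p > 0" if "prime p" for p :: nat using prime_gt_0_nat[OF that] by simp
  have "(\<Sum>p | prime p \<and> p \<le> n. ln (real p)) = ln (\<Prod>p | prime p \<and> p \<le> n. real p)"
    using pos by (subst ln_prod) auto
  also have "(\<Prod>p | prime p \<and> p \<le> n. real p) = real (primorial n)"
    by (simp add: primorial_def)
  also have "ln (real (primorial n)) \<le> ln (4 ^ n)"
  proof (rule ln_mono)
    have "primorial n > 0" unfolding primorial_def by (intro prod_pos) (auto dest: prime_gt_0_nat)
    then show "0 < real (primorial n)" by simp
    show "real (primorial n) \<le> 4 ^ n" using primorial_le[of n] by (metis of_nat_le_iff of_nat_numeral of_nat_power)
  qed
  also have "\<dots> = real n * ln 4" by (simp add: ln_realpow)
  finally show ?thesis .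
qed

lemma prime_power_dvd_fact: "p > 0 \<Longrightarrow> p ^ j dvd (fact (p * j) :: nat)"
proof (induction j)
  case (Suc j)
  have "fact (p * Suc j) = p * Suc j * (fact (p * Suc j - 1) :: nat)"
    using Suc.prems by (subst fact_reduce) auto
  moreover have "p ^ j dvd (fact (p * Suc j - 1) :: nat)"
  proof -
    have "p * j \<le> p * Suc j - 1" using Suc.prems by simp
    then have "(fact (p * j) :: nat) dvd fact (p * Suc j - 1)" by (rule fact_dvd)
    then show ?thesis using Suc by (meson dvd_trans)
  qed
  ultimately show ?case by (metis dvd_mult2 dvd_triv_left mult.assoc mult.left_commute mult_dvd_mono power_Suc)
qed simp

lemma ln_fact_le: "n \<ge> 1 \<Longrightarrow> ln (fact n) \<le> real n * ln (real n) - real n + 1 + ln (real n)"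
proof (induction n rule: dec_induct)
  case (step n)
  let ?x = "real n"
  have x: "?x > 0" using step by simp
  have "ln (fact (Suc n)) = ln (?x + 1) + ln (fact n)"
    by (simp add: ln_mult add.commute)
  also have "\<dots> \<le> ln (?x + 1) + (?x * ln ?x - ?x + 1 + ln ?x)" using step by simp
  also have "(?x + 1) * ln ?x + 1 \<le> (?x + 1) * ln (?x + 1)"
  proof -
    have "ln (?x / (?x + 1)) \<le> ?x / (?x + 1) - 1" using x by (intro ln_le_minus_one) auto
    also have "\<dots> = - 1 / (?x + 1)" using x by (simp add: field_simps)
    finally have "ln ?x - ln (?x + 1) \<le> - 1 / (?x + 1)" using x by (simp add: ln_div)
    then have "(ln ?x - ln (?x + 1)) * (?x + 1) \<le> - 1 / (?x + 1) * (?x + 1)" using x by (intro mult_right_mono) auto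
    also have "\<dots> = - 1" using x by simp
    finally have "(ln ?x - ln (?x + 1)) * (?x + 1) \<le> - 1" .
    then show ?thesis by (simp add: algebra_simps)
  qed
  then have "ln (?x + 1) + (?x * ln ?x - ?x + 1 + ln ?x) \<le> (?x + 1) * ln (?x + 1) - (?x + 1) + 1 + ln (?x + 1)"
    by (simp add: algebra_simps)
  finally show ?case by (simp add: add.commute)
qed simp

text \<open>Mertens' argument: \<open>p ^ (n div p)\<close> divides \<open>n!\<close> for all \<open>p \<le> n\<close>, and replacing \<open>n div p\<close> by
  \<open>n / p\<close> costs Chebyshev's function at \<open>n\<close>.\<close>
lemma sum_ln_over_prime_le:
  assumes "n \<ge> 1"
  shows "(\<Sum>p | prime p \<and> p \<le> n. ln (real p) / real p) \<le> ln (real n) + (ln 4 - 1) + (1 + ln (real n)) / real n"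
proof -
  let ?A = "{p. prime p \<and> p \<le> n}"
  have pos: "real p > 0" "ln (real p) \<ge> 0" if "p \<in> ?A" for p :: nat
    using that prime_gt_0_nat[of p] by (auto intro: prime_ge_1_nat)
  have "(\<Prod>p\<in>?A. p ^ (n div p)) dvd fact n"
  proof (rule prod_primes_dvd)
    fix p assume "p \<in> ?A"
    then have "p ^ (n div p) dvd (fact (p * (n div p)) :: nat)"
      by (intro prime_power_dvd_fact) (auto dest: prime_gt_0_nat)
    also have "\<dots> dvd fact n" by (intro fact_dvd) simp
    finally show "p ^ (n div p) dvd fact n" .
  qed auto
  then have "(\<Prod>p\<in>?A. p ^ (n div p)) \<le> fact n" by (rule dvd_imp_le) simp
  then have "real (\<Prod>p\<in>?A. p ^ (n div p)) \<le> real (fact n)" by (simp only: of_nat_le_iff)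
  then have le: "(\<Prod>p\<in>?A. real p ^ (n div p)) \<le> fact n" by simp
  have "(\<Sum>p\<in>?A. real (n div p) * ln (real p)) = ln (\<Prod>p\<in>?A. real p ^ (n div p))"
    using pos by (subst ln_prod) (auto simp: ln_realpow)
  also have "\<dots> \<le> ln (fact n)" using pos le by (intro ln_mono prod_pos) auto
  also have "\<dots> \<le> real n * ln (real n) - real n + 1 + ln (real n)" by (rule ln_fact_le[OF assms])
  finally have 1: "(\<Sum>p\<in>?A. real (n div p) * ln (real p)) \<le> real n * ln (real n) - real n + 1 + ln (real n)" .
  have "real n * (\<Sum>p\<in>?A. ln (real p) / real p) = (\<Sum>p\<in>?A. real n / real p * ln (real p))"
    by (simp add: sum_distrib_left)
  also have "\<dots> \<le> (\<Sum>p\<in>?A. (real (n div p) + 1) * ln (real p))"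
  proof (intro sum_mono mult_right_mono)
    fix p assume p: "p \<in> ?A"
    then have "n < p + (n div p) * p" by (intro dividend_less_div_times) (auto dest: prime_gt_0_nat)
    then have "real n \<le> real (p + (n div p) * p)" by (simp only: of_nat_le_iff less_imp_le)
    then show "real n / real p \<le> real (n div p) + 1" using pos(1)[OF p] by (simp add: field_simps)
  qed (use pos in auto)
  also have "\<dots> = (\<Sum>p\<in>?A. real (n div p) * ln (real p)) + (\<Sum>p\<in>?A. ln (real p))"
    by (simp add: algebra_simps sum.distrib)
  also have "\<dots> \<le> real n * ln (real n) - real n + 1 + ln (real n) + real n * ln 4"
    by (intro add_mono 1 chebyshev_theta_le)
  also have "\<dots> = real n * (ln (real n) + (ln 4 - 1) + (1 + ln (real n)) / real n)"
    using assms by (simp add: field_simps)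
  finally show ?thesis using assms by (simp only: mult_le_cancel_left_pos of_nat_0_less_iff less_eq_Suc_le One_nat_def)
qed

text \<open>The terms are dominated by the decrements of \<open>(ln x + 2) / x\<close>.\<close>
lemma sum_ln_over_consecutive_le:
  "n \<ge> 1 \<Longrightarrow> (\<Sum>m = 2..n. ln (real m) / (real m * (real m - 1))) \<le> 2 - (ln (real n) + 2) / real n"
proof (induction n rule: dec_induct)
  case (step n)
  let ?x = "real n"
  have x: "?x \<ge> 1" using step by simp
  have "ln (?x + 1) - ln ?x = ln (1 + 1 / ?x)" using x ln_div[of "?x + 1" ?x] by (simp add: add_divide_distrib)
  also have "\<dots> \<le> 1 / ?x" using x by (intro ln_add_one_self_le_self) auto
  finally have "(?x + 1) * (ln (?x + 1) - ln ?x) \<le> (?x + 1) * (1 / ?x)" using x by (intro mult_left_mono) auto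
  also have "\<dots> \<le> 2" using x by (simp add: field_simps)
  finally have "ln (?x + 1) \<le> (?x + 1) * (ln ?x + 2) - ?x * (ln (?x + 1) + 2)" by (simp add: algebra_simps)
  then have "ln (?x + 1) / ((?x + 1) * ?x) \<le> ((?x + 1) * (ln ?x + 2) - ?x * (ln (?x + 1) + 2)) / ((?x + 1) * ?x)"
    using x by (intro divide_right_mono) auto
  also have "\<dots> = (ln ?x + 2) / ?x - (ln (?x + 1) + 2) / (?x + 1)"
    using x by (simp add: diff_divide_distrib)
  finally have *: "ln (?x + 1) / ((?x + 1) * ?x) \<le> (ln ?x + 2) / ?x - (ln (?x + 1) + 2) / (?x + 1)" .
  have "(\<Sum>m = 2..Suc n. ln (real m) / (real m * (real m - 1)))
      = (\<Sum>m = 2..n. ln (real m) / (real m * (real m - 1))) + ln (?x + 1) / ((?x + 1) * ?x)"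
    using step by (simp add: add.commute)
  with * step show ?case by (simp add: add.commute)
qed simp

section \<open>The product of Mertens by comparison with the zeta function\<close>

text \<open>Comparison with the decrements of \<open>n powr - \<epsilon> / \<epsilon>\<close>, an antiderivative of the summand up to sign.\<close>
lemma sum_powr_le:
  assumes "\<epsilon> > 0"
  shows "N \<ge> 1 \<Longrightarrow> (\<Sum>n=1..N. real n powr - (1 + \<epsilon>)) \<le> 1 + 1 / \<epsilon> - real N powr - \<epsilon> / \<epsilon>"
proof (induction N rule: dec_induct)
  case (step n)
  let ?x = "real n + 1"
  have n: "real n > 0" using step by simp
  have "ln (real n / ?x) \<le> real n / ?x - 1" using n by (intro ln_le_minus_one) auto
  then have "\<epsilon> * (1 / ?x) \<le> \<epsilon> * (ln ?x - ln (real n))"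
    using n assms by (intro mult_left_mono) (auto simp: ln_div field_simps)
  then have "1 + \<epsilon> / ?x \<le> 1 + \<epsilon> * (ln ?x - ln (real n))" by simp
  also have "\<dots> \<le> exp (\<epsilon> * (ln ?x - ln (real n)))" by (rule exp_ge_add_one_self)
  also have "\<dots> = real n powr - \<epsilon> / ?x powr - \<epsilon>"
    using n by (simp add: powr_def exp_diff[symmetric] algebra_simps)
  finally have "(1 + \<epsilon> / ?x) * ?x powr - \<epsilon> \<le> real n powr - \<epsilon>" using n by (simp add: pos_le_divide_eq)
  moreover have "?x powr - (1 + \<epsilon>) = ?x powr - \<epsilon> / ?x"
    using n by (simp add: powr_diff powr_minus powr_add field_simps)
  ultimately have "\<epsilon> * ?x powr - (1 + \<epsilon>) \<le> real n powr - \<epsilon> - ?x powr - \<epsilon>"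
    by (simp add: algebra_simps)
  then have "?x powr - (1 + \<epsilon>) \<le> (real n powr - \<epsilon> - ?x powr - \<epsilon>) / \<epsilon>"
    using assms by (simp add: pos_le_divide_eq mult.commute)
  then show ?case using step by (simp add: diff_divide_distrib add.commute)
qed simp

lemma finite_sum_powr_le:
  assumes "\<epsilon> > 0" "finite F" "F \<subseteq> {0::nat<..}"
  shows "(\<Sum>n\<in>F. real n powr - (1 + \<epsilon>)) \<le> 1 + 1 / \<epsilon>"
proof -
  obtain N where N: "\<And>n. n \<in> F \<Longrightarrow> n \<le> N" using assms(2) finite_nat_set_iff_bounded_le by auto
  have "(\<Sum>n\<in>F. real n powr - (1 + \<epsilon>)) \<le> (\<Sum>n=1..max 1 N. real n powr - (1 + \<epsilon>))"
    using assms N by (intro sum_mono2) (auto simp: Suc_le_eq le_max_iff_disj)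
  also have "\<dots> \<le> 1 + 1 / \<epsilon> - real (max 1 N) powr - \<epsilon> / \<epsilon>" by (intro sum_powr_le assms) simp
  also have "\<dots> \<le> 1 + 1 / \<epsilon>" using assms by simp
  finally show ?thesis .
qed

lemma powr_summable_on:
  assumes "\<epsilon> > 0" "A \<subseteq> {0::nat<..}"
  shows "(\<lambda>n. real n powr - (1 + \<epsilon>)) summable_on A"
proof (rule summable_on_subset_banach[OF _ assms(2)], rule nonneg_bdd_above_summable_on)
  show "bdd_above (sum (\<lambda>n. real n powr - (1 + \<epsilon>)) ` {F. F \<subseteq> {0::nat<..} \<and> finite F})"
    using finite_sum_powr_le[OF assms(1)] by (intro bdd_aboveI2[where M = "1 + 1 / \<epsilon>"]) auto
qed simp

definition no_factor_in :: "nat set \<Rightarrow> nat set" where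
  "no_factor_in A = {n. n > 0 \<and> (\<forall>p\<in>A. \<not> p dvd n)}"

text \<open>One step of the sieve of Eratosthenes.\<close>
lemma no_factor_in_split:
  assumes "prime p" "\<And>q. q \<in> A \<Longrightarrow> prime q" "p \<notin> A"
  shows "no_factor_in A = no_factor_in (insert p A) \<union> (\<lambda>m. p * m) ` no_factor_in A"
    "no_factor_in (insert p A) \<inter> (\<lambda>m. p * m) ` no_factor_in A = {}"
proof -
  have ndvd: "\<not> q dvd p" if "q \<in> A" for q
    using assms that by (metis primes_dvd_imp_eq)
  have p: "p > 0" using assms(1) by (rule prime_gt_0_nat)
  show "no_factor_in A = no_factor_in (insert p A) \<union> (\<lambda>m. p * m) ` no_factor_in A"
  proof (intro set_eqI iffI)
    fix n assume n: "n \<in> no_factor_in A"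
    show "n \<in> no_factor_in (insert p A) \<union> (\<lambda>m. p * m) ` no_factor_in A"
    proof (cases "p dvd n")
      case True
      then obtain m where m: "n = p * m" by blast
      then have "m \<in> no_factor_in A" using n by (auto simp: no_factor_in_def)
      then show ?thesis using m by blast
    qed (use n in \<open>auto simp: no_factor_in_def\<close>)
  next
    fix n assume "n \<in> no_factor_in (insert p A) \<union> (\<lambda>m. p * m) ` no_factor_in A"
    then show "n \<in> no_factor_in A"
      using p assms ndvd by (auto simp: no_factor_in_def prime_dvd_mult_iff)
  qed
  show "no_factor_in (insert p A) \<inter> (\<lambda>m. p * m) ` no_factor_in A = {}"
    by (auto simp: no_factor_in_def)
qed

text \<open>The Euler product, one prime at a time: removing the multiples of \<open>p\<close> multiplies the Dirichlet
  series by \<open>1 - p powr - (1 + \<epsilon>)\<close>.\<close>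
lemma infsum_no_factor_in:
  assumes "\<epsilon> > 0" "finite A" "\<And>q. q \<in> A \<Longrightarrow> prime q"
  shows "(\<Sum>\<^sub>\<infinity>n\<in>no_factor_in A. real n powr - (1 + \<epsilon>))
       = (\<Prod>p\<in>A. 1 - real p powr - (1 + \<epsilon>)) * (\<Sum>\<^sub>\<infinity>n\<in>{0<..}. real n powr - (1 + \<epsilon>))"
  using assms(2,3)
proof (induction A rule: finite_induct)
  case empty
  have "no_factor_in {} = {0<..}" by (auto simp: no_factor_in_def)
  then show ?case by simp
next
  case (insert p A)
  let ?f = "\<lambda>n. real n powr - (1 + \<epsilon>)"
  have p: "prime p" "p > 0" using insert.prems prime_gt_0_nat by auto
  note split = no_factor_in_split[OF p(1) _ insert.hyps(2)]
  have sub: "no_factor_in B \<subseteq> {0<..}" for B by (auto simp: no_factor_in_def)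
  have sub': "(\<lambda>m. p * m) ` no_factor_in A \<subseteq> {0<..}" using p by (auto simp: no_factor_in_def)
  have "infsum ?f (no_factor_in A) = infsum ?f (no_factor_in (insert p A)) + infsum ?f ((\<lambda>m. p * m) ` no_factor_in A)"
    using infsum_Un_disjoint[OF powr_summable_on[OF assms(1) sub] powr_summable_on[OF assms(1) sub'] split(2)]
      split(1) insert.prems by simp
  also have "infsum ?f ((\<lambda>m. p * m) ` no_factor_in A) = infsum (?f \<circ> (\<lambda>m. p * m)) (no_factor_in A)"
    using p by (intro infsum_reindex inj_onI) auto
  also have "\<dots> = infsum (\<lambda>m. ?f p * ?f m) (no_factor_in A)"
    by (intro infsum_cong) (simp add: powr_mult)
  also have "\<dots> = ?f p * infsum ?f (no_factor_in A)" by (rule infsum_cmult_right')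
  finally have "infsum ?f (no_factor_in (insert p A)) = (1 - ?f p) * infsum ?f (no_factor_in A)"
    by (simp add: algebra_simps)
  then show ?case using insert by simp
qed

text \<open>The integer 1 survives every sieve, and \<open>1 + 1 / \<epsilon>\<close> bounds the zeta function at \<open>1 + \<epsilon>\<close>.\<close>
lemma prod_le_zeta:
  assumes "\<epsilon> > 0" "finite A" "\<And>q. q \<in> A \<Longrightarrow> prime q"
  shows "1 \<le> (\<Prod>p\<in>A. 1 - real p powr - (1 + \<epsilon>)) * (1 + 1 / \<epsilon>)"
proof -
  let ?f = "\<lambda>n. real n powr - (1 + \<epsilon>)"
  have "sum ?f {1} \<le> infsum ?f (no_factor_in A)"
    using assms(1) assms(3)[of 1] by (intro finite_sum_le_infsum powr_summable_on) (auto simp: no_factor_in_def)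
  then have "1 \<le> infsum ?f (no_factor_in A)" by simp
  also have "\<dots> = (\<Prod>p\<in>A. 1 - ?f p) * infsum ?f {0<..}" by (rule infsum_no_factor_in[OF assms])
  also have "\<dots> \<le> (\<Prod>p\<in>A. 1 - ?f p) * (1 + 1 / \<epsilon>)"
  proof (intro mult_left_mono infsum_le_finite_sums powr_summable_on prod_nonneg)
    fix p assume "p \<in> A"
    then have "real p \<ge> 1" using assms(3) prime_ge_1_nat by fastforce
    then have "real p powr - (1 + \<epsilon>) \<le> real p powr 0" using assms(1) by (intro powr_mono) auto
    then show "0 \<le> 1 - ?f p" using \<open>real p \<ge> 1\<close> by simp
  qed (use assms(1) finite_sum_powr_le in auto)
  finally show ?thesis .
qed

definition mertens_prod :: "nat \<Rightarrow> real" where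
  "mertens_prod z = (\<Prod>p | prime p \<and> p \<le> z. real p / (real p - 1))"

text \<open>Rankin's trick: compare the product at exponent 1 with the Euler product at exponent \<open>1 + \<epsilon>\<close>.
  The quotient of the local factors is \<open>1 + (1 - p powr - \<epsilon>) / (p - 1)\<close>, which is at most
  \<open>exp (\<epsilon> * ln p / (p - 1))\<close>.\<close>
lemma mertens_prod_le_exp:
  assumes "\<epsilon> > 0"
  shows "mertens_prod z \<le> (1 + 1 / \<epsilon>) * exp (\<epsilon> * (\<Sum>p | prime p \<and> p \<le> z. ln (real p) / (real p - 1)))"
proof -
  let ?A = "{p. prime p \<and> p \<le> z}"
  let ?f = "\<lambda>n. real n powr - (1 + \<epsilon>)"
  have p2: "real p \<ge> 2" if "p \<in> ?A" for p using that prime_ge_2_nat by fastforce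
  have fac: "0 \<le> real p / (real p - 1) * (1 - ?f p) \<and>
     real p / (real p - 1) * (1 - ?f p) \<le> exp (\<epsilon> * (ln (real p) / (real p - 1)))" if "p \<in> ?A" for p
  proof
    let ?x = "real p"
    have x: "?x \<ge> 2" by (rule p2[OF that])
    have f: "?f p = ?x powr - \<epsilon> / ?x" using x by (simp add: powr_diff powr_minus powr_add field_simps)
    have "?x powr - \<epsilon> \<le> ?x powr 0" using assms x by (intro powr_mono) auto
    then have le1: "?x powr - \<epsilon> \<le> 1" using x by simp
    have "?f p \<le> 1" unfolding f using le1 x by (simp add: divide_le_eq)
    then show "0 \<le> ?x / (?x - 1) * (1 - ?f p)" using x by (intro mult_nonneg_nonneg) auto
    have "?x / (?x - 1) * (1 - ?f p) = 1 + (1 - ?x powr - \<epsilon>) / (?x - 1)"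
      unfolding f using x by (simp add: field_simps)
    also have "1 - ?x powr - \<epsilon> \<le> \<epsilon> * ln ?x"
      using exp_ge_add_one_self[of "- \<epsilon> * ln ?x"] x by (simp add: powr_def)
    then have "1 + (1 - ?x powr - \<epsilon>) / (?x - 1) \<le> 1 + \<epsilon> * (ln ?x / (?x - 1))"
      using x divide_right_mono[of "1 - ?x powr - \<epsilon>" "\<epsilon> * ln ?x" "?x - 1"] by simp
    also have "\<dots> \<le> exp (\<epsilon> * (ln ?x / (?x - 1)))" by (rule exp_ge_add_one_self)
    finally show "?x / (?x - 1) * (1 - ?f p) \<le> exp (\<epsilon> * (ln ?x / (?x - 1)))" .
  qed
  have "mertens_prod z \<ge> 0" unfolding mertens_prod_def by (intro prod_nonneg) (auto dest: prime_ge_1_nat)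
  moreover have "1 \<le> (\<Prod>p\<in>?A. 1 - ?f p) * (1 + 1 / \<epsilon>)" by (intro prod_le_zeta assms) auto
  ultimately have "mertens_prod z * 1 \<le> mertens_prod z * ((\<Prod>p\<in>?A. 1 - ?f p) * (1 + 1 / \<epsilon>))" by (intro mult_left_mono)
  also have "\<dots> = (\<Prod>p\<in>?A. real p / (real p - 1) * (1 - ?f p)) * (1 + 1 / \<epsilon>)"
    unfolding mertens_prod_def prod.distrib by (rule mult.assoc[symmetric])
  also have "\<dots> \<le> (\<Prod>p\<in>?A. exp (\<epsilon> * (ln (real p) / (real p - 1)))) * (1 + 1 / \<epsilon>)"
    using fac assms by (intro mult_right_mono prod_mono) auto
  also have "\<dots> = exp (\<epsilon> * (\<Sum>p\<in>?A. ln (real p) / (real p - 1))) * (1 + 1 / \<epsilon>)"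
    by (simp add: exp_sum sum_distrib_left)
  finally show ?thesis by (simp add: mult.commute)
qed

text \<open>The difference of \<open>1 / (p - 1)\<close> and \<open>1 / p\<close> is \<open>1 / (p * (p - 1))\<close>, whose contribution stays
  below 2 even when extended to all integers.\<close>
lemma sum_ln_over_prime_minus_1_le:
  assumes "n \<ge> 1"
  shows "(\<Sum>p | prime p \<and> p \<le> n. ln (real p) / (real p - 1))
         \<le> ln (real n) + (ln 4 + 1) + (1 + ln (real n)) / real n"
proof -
  let ?A = "{p. prime p \<and> p \<le> n}"
  have p2: "real p \<ge> 2" if "p \<in> ?A" for p using that prime_ge_2_nat by fastforce
  have "(\<Sum>p\<in>?A. ln (real p) / (real p - 1))
      = (\<Sum>p\<in>?A. ln (real p) / real p + ln (real p) / (real p * (real p - 1)))"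
    using p2 by (intro sum.cong refl) (force simp: divide_simps algebra_simps)
  also have "\<dots> = (\<Sum>p\<in>?A. ln (real p) / real p) + (\<Sum>p\<in>?A. ln (real p) / (real p * (real p - 1)))"
    by (rule sum.distrib)
  also have "(\<Sum>p\<in>?A. ln (real p) / (real p * (real p - 1))) \<le> (\<Sum>m=2..n. ln (real m) / (real m * (real m - 1)))"
    by (intro sum_mono2) (auto dest: prime_ge_2_nat)
  also have "\<dots> \<le> 2 - (ln (real n) + 2) / real n" by (rule sum_ln_over_consecutive_le[OF assms])
  also have "\<dots> \<le> 2" using assms by simp
  also have "(\<Sum>p\<in>?A. ln (real p) / real p) \<le> ln (real n) + (ln 4 - 1) + (1 + ln (real n)) / real n"
    by (rule sum_ln_over_prime_le[OF assms])
  finally show ?thesis by simp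
qed

text \<open>With \<open>\<epsilon> = 1 / (ln z + C)\<close>, where \<open>ln z + C\<close> bounds the sum of \<open>ln p / (p - 1)\<close>, Rankin's bound
  becomes \<open>exp 1 * (1 + ln z + C)\<close>. For \<open>C = 2.446\<close> this is below \<open>4.7 * ln z\<close> once \<open>ln z \<ge> 4.75\<close>.\<close>
lemma mertens_prod_le_large:
  assumes "z \<ge> 128"
  shows "mertens_prod z \<le> 47/10 * ln (real z)"
proof -
  define l where "l = ln (real z)"
  \<comment> \<open>Exceeds \<open>ln 4 + 1 + 46/1000\<close> with \<open>ln 4 \<le> 25/18\<close>.\<close>
  define C where "C = (2446/1000 :: real)"
  have z: "real z \<ge> 128" using assms by simp
  have ln128: "ln (128::real) = 7 * ln 2" using ln_realpow[of 2 7] by simp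
  have ln4: "ln (4::real) = 2 * ln 2" using ln_realpow[of 2 2] by simp
  have l: "l \<ge> 475/100"
  proof -
    have "exp (19 :: real) = exp 1 ^ 19" by (simp flip: exp_of_nat_mult)
    also have "\<dots> \<le> (272/100) ^ 19" using e_less_272 by (intro power_mono) auto
    also have "\<dots> \<le> 128 ^ 4" by (simp add: power_divide)
    finally have "19 \<le> ln ((128::real) ^ 4)" by (subst ln_ge_iff) auto
    also have "\<dots> = 4 * ln 128" by (subst ln_realpow) auto
    finally have "475/100 \<le> ln (128::real)" by simp
    also have "\<dots> \<le> l" unfolding l_def using z by simp
    finally show ?thesis .
  qed
  have "(1 + l) / real z \<le> 46/1000"
  proof -
    have "ln (real z / 128) \<le> real z / 128 - 1" using z by (intro ln_le_minus_one) auto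
    then have "l \<le> real z / 128 - 1 + 7 * (25/36)"
      using z ln2_le_25_over_36 by (simp add: l_def ln_div ln128)
    then have "1 + l \<le> 46/1000 * real z" using z by simp
    then show ?thesis using z by (simp add: pos_divide_le_eq)
  qed
  then have "(\<Sum>p | prime p \<and> p \<le> z. ln (real p) / (real p - 1)) \<le> l + C"
  proof -
    assume a: "(1 + l) / real z \<le> 46/1000"
    have "(\<Sum>p | prime p \<and> p \<le> z. ln (real p) / (real p - 1)) \<le> l + (ln 4 + 1) + (1 + l) / real z"
      unfolding l_def using assms by (intro sum_ln_over_prime_minus_1_le) simp
    with a show ?thesis using ln2_le_25_over_36 ln4 unfolding C_def by linarith
  qed
  moreover define \<epsilon> where "\<epsilon> = 1 / (l + C)"
  moreover have lC: "l + C > 0" using l by (simp add: C_def)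
  ultimately have "mertens_prod z \<le> (1 + 1 / \<epsilon>) * exp (\<epsilon> * (l + C))"
    using mertens_prod_le_exp[of \<epsilon> z] by (smt (verit) exp_le_cancel_iff mult_left_mono zero_less_divide_1_iff)
  also have "\<dots> = (1 + l + C) * exp 1" using lC by (simp add: \<epsilon>_def)
  also have "\<dots> \<le> (1 + l + C) * (272/100)" using lC e_less_272 by (intro mult_left_mono) auto
  also have "\<dots> \<le> 47/10 * l" using l by (simp add: C_def)
  finally show ?thesis by (simp add: l_def)
qed

section \<open>Lower bound for the sieve mass\<close>

lemma mertens_prod_mono_set:
  assumes "finite B" "{p. prime p \<and> p \<le> z} \<subseteq> B" "\<And>b. b \<in> B \<Longrightarrow> b \<ge> 2"
  shows "mertens_prod z \<le> (\<Prod>b\<in>B. real b / (real b - 1))"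
  unfolding mertens_prod_def
proof (rule prod_mono2[OF assms(1,2)])
  fix b assume "b \<in> B - {p. prime p \<and> p \<le> z}"
  then have "real b \<ge> 2" using assms(3)[of b] by simp
  then show "1 \<le> real b / (real b - 1)" by (simp add: le_divide_eq)
next
  fix b assume "b \<in> {p. prime p \<and> p \<le> z}"
  then have "real b \<ge> 2" using prime_ge_2_nat[of b] by simp
  then show "0 \<le> real b / (real b - 1)" by simp
qed

text \<open>The integers from 2 to 127 with no proper divisor among 2, 3, 5, 7. Besides primes these include
  only 121, which spares the division by 11 and merely increases the product.\<close>
definition prime_candidates :: "nat list" where
  "prime_candidates = [2, 3, 5, 7, 11, 13, 17, 19, 23, 29, 31, 37, 41, 43, 47, 53, 59, 61, 67, 71, 73, 79,
     83, 89, 97, 101, 103, 107, 109, 113, 121, 127]"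

lemma prime_candidates_complete:
  assumes "prime p" "p < 128"
  shows "p \<in> set prime_candidates"
proof -
  have "\<forall>m\<in>set [0..<128]. m < 2 \<or> m \<in> set prime_candidates \<or> (\<exists>d\<in>set [2, 3, 5, 7]. m \<noteq> d \<and> m mod d = 0)"
    unfolding prime_candidates_def by code_simp
  then have "p < 2 \<or> p \<in> set prime_candidates \<or> (\<exists>d\<in>set [2, 3, 5, 7]. p \<noteq> d \<and> p mod d = 0)"
    by (rule bspec) (use assms(2) in simp)
  then show ?thesis
  proof (elim disjE bexE conjE)
    assume "p < 2"
    then show ?thesis using prime_ge_2_nat[OF assms(1)] by simp
  next
    fix d assume d: "d \<in> set [2, 3, 5, 7]" "p \<noteq> d" "p mod d = 0"
    then have "d dvd p" by (simp only: dvd_eq_mod_eq_0)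
    then have "d = 1 \<or> d = p" using assms(1) by (meson prime_nat_iff)
    then show ?thesis using d(1,2) by auto
  qed
qed

text \<open>Below 128, where Rankin's bound is too weak, two evaluations suffice: the product over the
  primes below 11 against \<open>ln 4\<close>, and the product over \<open>prime_candidates\<close> against \<open>ln 8\<close>.\<close>
lemma mertens_prod_le:
  assumes "z \<ge> 4"
  shows "mertens_prod z \<le> 47/10 * ln (real z)"
proof -
  have ln8: "ln (8::real) = 3 * ln 2" using ln_realpow[of 2 3] by simp
  have ln4: "ln (4::real) = 2 * ln 2" using ln_realpow[of 2 2] by simp
  consider "z < 11" | "11 \<le> z" "z < 128" | "z \<ge> 128" by linarith
  then show ?thesis
  proof cases
    case 1
    have "{p. prime p \<and> p \<le> z} \<subseteq> {2, 3, 5, 7}"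
    proof
      fix p assume "p \<in> {p. prime p \<and> p \<le> z}"
      then have "p \<in> set prime_candidates" "p < 11" using 1 by (auto intro: prime_candidates_complete)
      then show "p \<in> {2, 3, 5, 7}" by (auto simp: prime_candidates_def)
    qed
    then have "mertens_prod z \<le> (\<Prod>b\<in>{2, 3, 5, 7}. real b / (real b - 1))"
      by (intro mertens_prod_mono_set) auto
    also have "\<dots> \<le> 47/10 * ln 4" using ln2_ge_two_thirds by (simp add: ln4)
    also have "\<dots> \<le> 47/10 * ln (real z)" using assms by simp
    finally show ?thesis .
  next
    case 2
    have "mertens_prod z \<le> (\<Prod>b\<in>set prime_candidates. real b / (real b - 1))"
    proof (rule mertens_prod_mono_set)
      show "{p. prime p \<and> p \<le> z} \<subseteq> set prime_candidates"
        using 2 by (auto intro: prime_candidates_complete)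
    qed (auto simp: prime_candidates_def)
    also have "\<dots> \<le> 47/10 * ln 8" using ln2_ge_two_thirds by (simp add: ln8 prime_candidates_def)
    also have "\<dots> \<le> 47/10 * ln (real z)" using 2 by simp
    finally show ?thesis .
  next
    case 3
    then show ?thesis by (rule mertens_prod_le_large)
  qed
qed

lemma mertens_prod_pos: "mertens_prod z > 0"
  unfolding mertens_prod_def
proof (rule prod_pos)
  fix p assume "p \<in> {p. prime p \<and> p \<le> z}"
  then have "real p > 1" using prime_gt_1_nat by fastforce
  then show "0 < real p / (real p - 1)" by simp
qed

text \<open>Removing the multiples of one prime \<open>p\<close> from the harmonic sum loses at most the fraction \<open>1/p\<close>
  of it, because the multiples \<open>p * m\<close> arise from terms \<open>m\<close> of the same sum.\<close>
lemma harmonic_le_mertens_prod: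
  assumes "finite A" "\<And>q. q \<in> A \<Longrightarrow> prime q"
  shows "(\<Sum>n=1..R. 1 / real n) \<le> (\<Prod>p\<in>A. real p / (real p - 1)) * (\<Sum>n | n \<in> no_factor_in A \<and> n \<le> R. 1 / real n)"
  using assms
proof (induction A rule: finite_induct)
  case empty
  have "{n. n \<in> no_factor_in {} \<and> n \<le> R} = {1..R}" by (auto simp: no_factor_in_def)
  then show ?case by simp
next
  case (insert p A)
  define H where "H B = (\<Sum>n | n \<in> no_factor_in B \<and> n \<le> R. 1 / real n)" for B
  have p: "prime p" "real p > 1" using insert.prems prime_gt_1_nat by fastforce+
  note split = no_factor_in_split[OF p(1) _ insert.hyps(2)]
  let ?M = "{n. n \<in> (\<lambda>m. p * m) ` no_factor_in A \<and> n \<le> R}"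
  have fin: "finite {n. Q n \<and> n \<le> R}" for Q by (rule finite_subset[of _ "{..R}"]) auto
  have "{n. n \<in> no_factor_in A \<and> n \<le> R} = {n. n \<in> no_factor_in (insert p A) \<and> n \<le> R} \<union> ?M"
    using split(1) insert.prems by auto
  moreover have "{n. n \<in> no_factor_in (insert p A) \<and> n \<le> R} \<inter> ?M = {}"
    using split(2) insert.prems by auto
  ultimately have "H A = H (insert p A) + (\<Sum>n\<in>?M. 1 / real n)"
    unfolding H_def using fin by (simp add: sum.union_disjoint)
  also have "(\<Sum>n\<in>?M. 1 / real n) \<le> H A / real p"
  proof -
    let ?S = "{m. m \<in> no_factor_in A \<and> p * m \<le> R}"
    have "m \<le> R" if "p * m \<le> R" for m using that p by (metis le_trans mult_le_mono1 nat_mult_1 prime_ge_1_nat)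
    then have sub: "?S \<subseteq> {n. n \<in> no_factor_in A \<and> n \<le> R}" by auto
    have "?M = (\<lambda>m. p * m) ` ?S" by auto
    then have "(\<Sum>n\<in>?M. 1 / real n) = (\<Sum>m\<in>?S. 1 / real m / real p)"
      using p by (simp add: sum.reindex inj_on_def mult.commute)
    also have "\<dots> \<le> (\<Sum>m | m \<in> no_factor_in A \<and> m \<le> R. 1 / real m / real p)"
      using sub fin by (intro sum_mono2) auto
    finally show ?thesis by (simp add: H_def sum_divide_distrib)
  qed
  finally have "H A \<le> real p / (real p - 1) * H (insert p A)" using p(2) by (simp add: field_simps)
  moreover have "(\<Prod>q\<in>A. real q / (real q - 1)) \<ge> 0"
  proof (rule prod_nonneg)
    fix q assume "q \<in> A"
    then have "real q \<ge> 1" using insert.prems[of q] prime_ge_1_nat[of q] by simp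
    then show "0 \<le> real q / (real q - 1)" by simp
  qed
  ultimately have "(\<Prod>q\<in>A. real q / (real q - 1)) * H A \<le> (\<Prod>q\<in>A. real q / (real q - 1)) * (real p / (real p - 1) * H (insert p A))"
    by (intro mult_left_mono)
  moreover have "(\<Sum>n=1..R. 1 / real n) \<le> (\<Prod>q\<in>A. real q / (real q - 1)) * H A"
    using insert by (simp add: H_def)
  ultimately show ?case using insert.hyps by (simp add: H_def mult_ac)
qed

lemma prime_factors_prime_mult: "prime p \<Longrightarrow> m > 0 \<Longrightarrow> prime_factors (p * m) = insert p (prime_factors m)" for p m :: nat
  by (simp add: prime_factors_product prime_factorization_prime)

text \<open>Induction on \<open>A\<close>: a number \<open>n\<close> with support \<open>insert p A\<close> is \<open>p * m\<close> with \<open>m\<close> of support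
  \<open>insert p A\<close> or \<open>A\<close>, so the sum \<open>f\<close> for \<open>insert p A\<close> and the sum \<open>g\<close> for \<open>A\<close> satisfy
  \<open>f \<le> (f + g) / p\<close>.\<close>
lemma sum_fixed_prime_factors_le:
  assumes "finite A" "\<And>p. p \<in> A \<Longrightarrow> prime p"
  shows "(\<Sum>n | 0 < n \<and> n \<le> x \<and> prime_factors n = A. 1 / real n) \<le> (\<Prod>p\<in>A. 1 / (real p - 1))"
  using assms
proof (induction A rule: finite_induct)
  case empty
  have "{n. 0 < n \<and> n \<le> x \<and> prime_factors n = {}} \<subseteq> {1::nat}"
    by (auto simp: prime_factorization_empty_iff)
  then have "(\<Sum>n | 0 < n \<and> n \<le> x \<and> prime_factors n = {}. 1 / real n) \<le> (\<Sum>n\<in>{1}. 1 / real n)"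
    by (intro sum_mono2) auto
  then show ?case by simp
next
  case (insert p A)
  define G where "G B = {n. 0 < n \<and> n \<le> x \<and> prime_factors n = B}" for B :: "nat set"
  have p: "prime p" "real p > 1" using insert.prems prime_gt_1_nat by fastforce+
  have fin: "finite (G B)" for B unfolding G_def by (rule finite_subset[of _ "{..x}"]) auto
  have "G (insert p A) \<subseteq> (\<lambda>m. p * m) ` (G (insert p A) \<union> G A)"
  proof
    fix n assume n: "n \<in> G (insert p A)"
    then have "p dvd n" by (auto simp: G_def)
    then obtain m where m: "n = p * m" by blast
    have mpos: "m > 0" "m \<le> x" using n m p by (auto simp: G_def intro: le_trans[of m "p * m"])
    have "insert p (prime_factors m) = insert p A"
      using n mpos m prime_factors_prime_mult[OF p(1)] by (simp add: G_def)
    then have "prime_factors m = insert p A \<or> prime_factors m = A"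
      using insert.hyps(2) by (metis Diff_insert_absorb insert_absorb insert_Diff_single insert_ident)
    then show "n \<in> (\<lambda>m. p * m) ` (G (insert p A) \<union> G A)" using mpos m by (auto simp: G_def)
  qed
  then have "(\<Sum>n\<in>G (insert p A). 1 / real n) \<le> (\<Sum>n\<in>(\<lambda>m. p * m) ` (G (insert p A) \<union> G A). 1 / real n)"
    using fin by (intro sum_mono2) auto
  also have "\<dots> = (\<Sum>m\<in>G (insert p A) \<union> G A. 1 / real m) / real p"
    using p by (simp add: sum.reindex inj_on_def sum_divide_distrib mult.commute)
  also have "(\<Sum>m\<in>G (insert p A) \<union> G A. 1 / real m) = (\<Sum>m\<in>G (insert p A). 1 / real m) + (\<Sum>m\<in>G A. 1 / real m)"
    using fin insert.hyps(2) by (intro sum.union_disjoint) (auto simp: G_def)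
  finally have "(\<Sum>n\<in>G (insert p A). 1 / real n) \<le> 1 / (real p - 1) * (\<Sum>m\<in>G A. 1 / real m)"
    using p(2) by (simp add: field_simps)
  also have "\<dots> \<le> 1 / (real p - 1) * (\<Prod>p\<in>A. 1 / (real p - 1))"
    using insert p(2) by (intro mult_left_mono) (auto simp: G_def)
  finally show ?case using insert.hyps by (simp add: G_def)
qed

lemma totient_squarefree:
  assumes "squarefree r"
  shows "(\<Prod>p\<in>prime_factors r. 1 / (real p - 1)) = 1 / real (totient r)"
proof -
  have r: "r > 0" using assms by (auto intro!: Nat.gr0I)
  have "totient r = (\<Prod>p\<in>prime_factors r. p - 1)"
    unfolding totient_formula1[OF r]
  proof (intro prod.cong refl)
    fix p assume "p \<in> prime_factors r"
    then have "multiplicity p r = 1"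
      using assms r by (subst (asm) squarefree_factorial_semiring') auto
    then show "p ^ (multiplicity p r - 1) * (p - 1) = p - 1" by simp
  qed
  then have "real (totient r) = (\<Prod>p\<in>prime_factors r. real p - 1)"
    unfolding of_nat_prod
  proof (elim ssubst, unfold of_nat_prod, intro prod.cong refl)
    fix p assume "p \<in> prime_factors r"
    then have "p \<ge> 1" by (intro prime_ge_1_nat) auto
    then show "real (p - 1) = real p - 1" by (simp add: of_nat_diff)
  qed
  then show ?thesis by (simp add: prod_dividef)
qed

text \<open>Group the integers by the product of their prime factors, which is a sieve modulus.\<close>
lemma sum_no_factor_le_sieve_mass:
  "(\<Sum>n | n \<in> no_factor_in {p. prime p \<and> p \<le> z} \<and> n \<le> R. 1 / real n) \<le> sieve_mass z R"
proof -
  let ?N = "{n. n \<in> no_factor_in {p. prime p \<and> p \<le> z} \<and> n \<le> R}"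
  define rad where "rad n = \<Prod>(prime_factors n)" for n :: nat
  have fin: "finite ?N" by (rule finite_subset[of _ "{..R}"]) auto
  have pf_rad: "prime_factors (rad n) = prime_factors n" for n
  proof -
    have "prime_factors (rad n) = (\<Union>p\<in>prime_factors n. prime_factors p)"
      unfolding rad_def by (subst prime_factors_prod) auto
    also have "\<dots> = (\<Union>p\<in>prime_factors n. {p})"
    proof (intro SUP_cong refl)
      fix p assume "p \<in> prime_factors n"
      then have "prime p" by auto
      then show "prime_factors p = {p}" by (simp add: prime_factorization_prime)
    qed
    finally show ?thesis by simp
  qed
  have rad: "rad n \<in> sieve_moduli z R" if "n \<in> ?N" for n
  proof -
    have n: "n > 0" "n \<le> R" "\<And>p. prime p \<Longrightarrow> p \<le> z \<Longrightarrow> \<not> p dvd n" using that by (auto simp: no_factor_in_def)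
    have "(\<Prod>p\<in>prime_factors n. p ^ 1) dvd n" by (rule prod_primes_dvd) auto
    then have "rad n dvd n" by (simp add: rad_def)
    then have "rad n \<le> R" using n by (meson dvd_imp_le le_trans)
    moreover have "squarefree (rad n)" unfolding rad_def
      by (intro squarefree_prod_coprime) (auto intro: primes_coprime squarefree_prime)
    moreover have "z < p" if "prime p" "p dvd rad n" for p
      using n(3)[OF that(1)] that \<open>rad n dvd n\<close> by (meson dvd_trans not_less)
    ultimately show ?thesis by (simp add: sieve_moduli_def)
  qed
  have "(\<Sum>n\<in>?N. 1 / real n) = (\<Sum>r\<in>sieve_moduli z R. \<Sum>n | n \<in> ?N \<and> rad n = r. 1 / real n)"
    using rad by (intro sum.group[symmetric] fin finite_sieve_moduli) auto
  also have "\<dots> \<le> sieve_mass z R"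
    unfolding sieve_mass_def
  proof (rule sum_mono)
    fix r assume r: "r \<in> sieve_moduli z R"
    have "(\<Sum>n | n \<in> ?N \<and> rad n = r. 1 / real n) \<le> (\<Sum>n | 0 < n \<and> n \<le> R \<and> prime_factors n = prime_factors r. 1 / real n)"
    proof (rule sum_mono2)
      show "finite {n. 0 < n \<and> n \<le> R \<and> prime_factors n = prime_factors r}"
        by (rule finite_subset[of _ "{..R}"]) auto
    qed (auto simp: no_factor_in_def pf_rad)
    also have "\<dots> \<le> (\<Prod>p\<in>prime_factors r. 1 / (real p - 1))"
      by (intro sum_fixed_prime_factors_le) auto
    also have "\<dots> = 1 / real (totient r)" using r by (intro totient_squarefree) (auto simp: sieve_moduli_def)
    finally show "(\<Sum>n | n \<in> ?N \<and> rad n = r. 1 / real n) \<le> 1 / real (totient r)" .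
  qed
  finally show ?thesis .
qed

lemma sieve_mass_lower:
  assumes "z \<ge> 4"
  shows "ln (real R + 1) \<le> 47/10 * ln (real z) * sieve_mass z R"
proof -
  have "ln (real R + 1) \<le> harm R" by (rule ln_le_harm)
  also have "harm R = (\<Sum>n=1..R. 1 / real n)" by (simp add: harm_def inverse_eq_divide)
  also have "\<dots> \<le> mertens_prod z * (\<Sum>n | n \<in> no_factor_in {p. prime p \<and> p \<le> z} \<and> n \<le> R. 1 / real n)"
    unfolding mertens_prod_def by (rule harmonic_le_mertens_prod) auto
  also have "\<dots> \<le> mertens_prod z * sieve_mass z R"
    using mertens_prod_pos[of z] by (intro mult_left_mono sum_no_factor_le_sieve_mass) auto
  also have "\<dots> \<le> 47/10 * ln (real z) * sieve_mass z R"
    by (intro mult_right_mono mertens_prod_le assms sieve_mass_nonneg)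
  finally show ?thesis .
qed

section \<open>Points in Farey arcs\<close>

definition farey_index :: "real \<Rightarrow> (nat \<times> nat) set" where
  "farey_index Q = (SIGMA q:{q. 1 \<le> q \<and> real q \<le> Q}. {a. 1 \<le> a \<and> a \<le> q \<and> coprime a q})"

lemma finite_farey_index [simp]: "finite (farey_index Q)"
proof -
  have "finite {q. 1 \<le> q \<and> real q \<le> Q}"
    by (rule finite_subset[of _ "{..nat \<lfloor>Q\<rfloor>}"]) (auto simp: le_nat_iff le_floor_iff)
  then show ?thesis by (auto simp: farey_index_def)
qed

text \<open>Since \<open>totient q \<le> q - 1\<close> for \<open>q \<ge> 2\<close>, the sum is about half of the square only; this is what
  bounds the number of points by \<open>z / 2\<close>.\<close>
lemma sum_totient_le: "Q \<ge> 2 \<Longrightarrow> 2 * (\<Sum>q=1..Q. totient q) \<le> Q\<^sup>2"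
proof (induction Q rule: dec_induct)
  case base
  have "{1..2::nat} = {1, 2}" by auto
  then show ?case by simp
next
  case (step Q)
  have "totient (Suc Q) < Suc Q" using step by (intro totient_less) auto
  then show ?case using step by (simp add: power2_eq_square)
qed

lemma card_farey_index_le:
  assumes "Q \<ge> 2" "real Q \<le> Q\<^sub>0" "Q\<^sub>0 < real Q + 1"
  shows "2 * card (farey_index Q\<^sub>0) \<le> Q\<^sup>2"
proof -
  have "{q. 1 \<le> q \<and> real q \<le> Q\<^sub>0} = {1..Q}"
  proof (intro set_eqI iffI)
    fix q assume "q \<in> {q. 1 \<le> q \<and> real q \<le> Q\<^sub>0}"
    then have "real q < real Q + 1" "1 \<le> q" using assms by auto
    then show "q \<in> {1..Q}" by simp
  qed (use assms in auto)
  moreover have "{a. 1 \<le> a \<and> a \<le> q \<and> coprime a q} = totatives q" for q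
    by (auto simp: in_totatives_iff)
  ultimately have "card (farey_index Q\<^sub>0) = (\<Sum>q=1..Q. totient q)"
    by (simp add: farey_index_def totient_def)
  then show ?thesis using sum_totient_le[OF assms(1)] by simp
qed

text \<open>The hypothesis says that the vectors \<open>(q, A)\<close> and \<open>(q', A')\<close> lie in the same class of the
  projective line over the field with three elements, whose four points are encoded by 0, 1, 2
  (the slope \<open>A / q = A * q\<close>) and 3 (vertical).\<close>
lemma same_slope_mod_3_imp_dvd:
  fixes q A q' A' :: int
  assumes c: "(if 3 dvd q then 3 else (A * q) mod 3) = (if 3 dvd q' then 3 else (A' * q') mod 3)"
  shows "3 dvd A * q' - A' * q"
proof -
  have r: "x mod 3 < 3" for x :: int by simp
  have "3 dvd q \<longleftrightarrow> 3 dvd q'" using c r[of "A * q"] r[of "A' * q'"] by (auto split: if_splits)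
  show ?thesis
  proof (cases "3 dvd q")
    case True
    then show ?thesis using \<open>3 dvd q \<longleftrightarrow> 3 dvd q'\<close> by simp
  next
    case False
    have sq: "\<exists>m. x * x = 1 + 3 * m" if "\<not> 3 dvd x" for x :: int
    proof -
      have "x mod 3 = 1 \<or> x mod 3 = 2" using that by presburger
      then obtain s where "x = 3 * s + 1 \<or> x = 3 * s + 2" by (metis mult_div_mod_eq)
      then have "x * x = 1 + 3 * (3 * s * s + 2 * s) \<or> x * x = 1 + 3 * (3 * s * s + 4 * s + 1)"
        by (auto simp: algebra_simps)
      then show ?thesis by blast
    qed
    obtain m m' where m: "q * q = 1 + 3 * m" "q' * q' = 1 + 3 * m'"
      using sq False \<open>3 dvd q \<longleftrightarrow> 3 dvd q'\<close> by metis
    have "(A * q) mod 3 = (A' * q') mod 3" using c False \<open>3 dvd q \<longleftrightarrow> 3 dvd q'\<close> by simp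
    then have "3 dvd A * q - A' * q'" by (simp add: mod_eq_dvd_iff)
    then have "3 dvd q * q' * (A * q - A' * q')" by (rule dvd_mult)
    also have "q * q' * (A * q - A' * q') = A * q' * (q * q) - A' * q * (q' * q')"
      by (simp add: algebra_simps)
    also have "\<dots> = (A * q' - A' * q) + 3 * (A * q' * m - A' * q * m')"
      unfolding m by (simp add: algebra_simps)
    finally show ?thesis by (simp only: dvd_add_left_iff dvd_triv_left)
  qed
qed

text \<open>If the points of two arcs around \<open>a/q\<close> and \<open>a'/q'\<close> lie in one window of length \<open>1/M\<close>, then,
  after translating the fractions by integers, the determinant of the two primitive vectors
  \<open>(q, A)\<close> and \<open>(q', A')\<close> is less than 3 in absolute value. If the vectors moreover agree as
  points of the projective line modulo 3, it is divisible by 3, hence zero, and the vectors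
  coincide. So there are at most as many points as this projective line has.\<close>
lemma farey_arc_cluster:
  assumes Q0: "Q\<^sub>0 > 0" "M > 0" "\<And>q q'. 1 \<le> q \<Longrightarrow> real q \<le> Q\<^sub>0 \<Longrightarrow> 1 \<le> q' \<Longrightarrow> real q' \<le> Q\<^sub>0 \<Longrightarrow> q * q' \<le> M"
    and \<alpha>: "\<And>i. i \<in> farey_index Q\<^sub>0 \<Longrightarrow> \<alpha> i \<in> arc Q\<^sub>0 (fst i) (snd i)"
    and S: "S \<subseteq> farey_index Q\<^sub>0"
    and cl: "\<And>i. i \<in> S \<Longrightarrow> t \<le> \<alpha> i + of_int (k i) \<and> \<alpha> i + of_int (k i) < t + 1 / real M"
  shows "card S \<le> 4"
proof -
  \<comment> \<open>The numerators of the translated fractions \<open>a/q + k i\<close>.\<close>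
  define A where "A i = int (snd i) + k i * int (fst i)" for i
  define c where "c i = (if 3 dvd int (fst i) then 3 else (A i * int (fst i)) mod 3)" for i
  have "inj_on c S"
  proof (rule inj_onI)
    fix i j assume i: "i \<in> S" and j: "j \<in> S" and cij: "c i = c j"
    obtain q a where ia: "i = (q, a)" by force
    obtain q' a' where ja: "j = (q', a')" by force
    have q: "1 \<le> q" "real q \<le> Q\<^sub>0" "1 \<le> a" "a \<le> q" "coprime a q"
      and q': "1 \<le> q'" "real q' \<le> Q\<^sub>0" "1 \<le> a'" "a' \<le> q'" "coprime a' q'"
      using i j S ia ja by (auto simp: farey_index_def)
    have arcs: "\<bar>\<alpha> i - real a / real q\<bar> \<le> 1 / (real q * Q\<^sub>0)" "\<bar>\<alpha> j - real a' / real q'\<bar> \<le> 1 / (real q' * Q\<^sub>0)"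
      using \<alpha>[of i] \<alpha>[of j] i j S by (auto simp: arc_def ia ja)
    define x where "x = (\<alpha> i + of_int (k i)) - (\<alpha> j + of_int (k j))"
    have x: "\<bar>x\<bar> < 1 / real M" using cl[OF i] cl[OF j] unfolding x_def by linarith
    define d where "d = A i * int q' - A j * int q"
    have "real_of_int d = real q * real q' * (x - (\<alpha> i - real a / real q) + (\<alpha> j - real a' / real q'))"
      using q q' by (simp add: d_def A_def x_def ia ja field_simps)
    then have "\<bar>real_of_int d\<bar> = real q * real q' * \<bar>x - (\<alpha> i - real a / real q) + (\<alpha> j - real a' / real q')\<bar>"
      by (simp add: abs_mult)
    also have "\<dots> < real q * real q' * (1 / real M + 1 / (real q * Q\<^sub>0) + 1 / (real q' * Q\<^sub>0))"
      using arcs x q q' by (intro mult_strict_left_mono) auto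
    also have "\<dots> = real (q * q') / real M + real q' / Q\<^sub>0 + real q / Q\<^sub>0"
      using q q' Q0 by (simp add: field_simps)
    also have "\<dots> \<le> 1 + 1 + 1"
      using q q' Q0(1,2) Q0(3)[OF q(1,2) q'(1,2)] by (intro add_mono) (auto simp: divide_le_eq simp flip: of_nat_mult)
    finally have "\<bar>d\<bar> < 3" by linarith
    moreover have "3 dvd d"
    proof -
      have f: "fst i = q" "fst j = q'" by (simp_all add: ia ja)
      show ?thesis
        unfolding d_def by (rule same_slope_mod_3_imp_dvd[OF cij[unfolded c_def f]])
    qed
    ultimately have "d = 0" by presburger
    then have eq: "A i * int q' = A j * int q" by (simp add: d_def)
    have shift: "coprime (int c + l * int r) (int r)" if "coprime c r" for c r l
    proof -
      have "gcd (int r) (l * int r + int c) = gcd (int r) (int c)" by (rule gcd_add_mult)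
      also have "\<dots> = 1" using that by (simp add: coprime_iff_gcd_eq_1 gcd.commute)
      finally show ?thesis by (simp only: coprime_iff_gcd_eq_1 gcd.commute[of _ "int r"] add.commute)
    qed
    have co: "coprime (A i) (int q)" "coprime (A j) (int q')"
      using shift[OF q(5), of "k i"] shift[OF q'(5), of "k j"] by (simp_all add: A_def ia ja)
    have "int q dvd A i * int q'" using eq by simp
    then have "q dvd q'" using co(1) by (simp add: coprime_dvd_mult_right_iff coprime_commute)
    moreover have "int q' dvd A j * int q" using eq by (metis dvd_triv_right)
    then have "q' dvd q" using co(2) by (simp add: coprime_dvd_mult_right_iff coprime_commute)
    ultimately have qq: "q = q'" by (rule dvd_antisym)
    then have "A i = A j" using eq q by simp
    then have "int a - int a' = int q * (k j - k i)" using qq by (simp add: A_def ia ja algebra_simps)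
    then have "int q dvd int a - int a'" by simp
    moreover have "\<bar>int a - int a'\<bar> < int q" using q q' qq by auto
    ultimately have "a = a'" by (rule eq_of_dvd_diff)
    then show "i = j" using qq ia ja by simp
  qed
  moreover have "c ` S \<subseteq> {0, 1, 2, 3}"
  proof
    fix y assume "y \<in> c ` S"
    then have "0 \<le> y" "y \<le> 3" by (auto simp: c_def intro: less_imp_le)
    then show "y \<in> {0, 1, 2, 3}" by auto
  qed
  ultimately have "card S \<le> card {0, 1, 2, 3 :: int}" by (intro card_inj_on_le) auto
  then show ?thesis by simp
qed

text \<open>Apply the dual inequality to \<open>b i = cnj (\<Sum>p. u p * E i p)\<close> and use the Cauchy-Schwarz
  inequality.\<close>
lemma dual_to_primal:
  fixes E :: "'i \<Rightarrow> 'p \<Rightarrow> complex"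
  assumes "D \<ge> 0"
    and dual: "\<And>b. (\<Sum>p\<in>P. (norm (\<Sum>i\<in>I. b i * E i p))\<^sup>2) \<le> D * (\<Sum>i\<in>I. (norm (b i))\<^sup>2)"
  shows "(\<Sum>i\<in>I. (norm (\<Sum>p\<in>P. u p * E i p))\<^sup>2) \<le> D * (\<Sum>p\<in>P. (norm (u p))\<^sup>2)"
proof -
  define s where "s i = (\<Sum>p\<in>P. u p * E i p)" for i
  define t where "t p = (\<Sum>i\<in>I. cnj (s i) * E i p)" for p
  define X where "X = (\<Sum>i\<in>I. (norm (s i))\<^sup>2)"
  define U where "U = (\<Sum>p\<in>P. (norm (u p))\<^sup>2)"
  have X0: "X \<ge> 0" and U0: "U \<ge> 0" by (auto simp: X_def U_def intro: sum_nonneg)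
  have "complex_of_real X = (\<Sum>i\<in>I. s i * cnj (s i))"
    by (simp only: X_def of_real_sum complex_norm_square)
  also have "\<dots> = (\<Sum>i\<in>I. \<Sum>p\<in>P. u p * (cnj (s i) * E i p))"
    unfolding s_def[of _] sum_distrib_right by (intro sum.cong refl) (simp only: mult_ac)
  also have "\<dots> = (\<Sum>p\<in>P. u p * t p)"
    unfolding t_def sum_distrib_left by (rule sum.swap)
  finally have "X = norm (\<Sum>p\<in>P. u p * t p)" using X0 by (metis abs_of_nonneg norm_of_real)
  also have "\<dots> \<le> (\<Sum>p\<in>P. norm (u p) * norm (t p))"
    by (rule order.trans[OF norm_sum]) (simp add: norm_mult)
  finally have "X\<^sup>2 \<le> (\<Sum>p\<in>P. norm (u p) * norm (t p))\<^sup>2" using X0 by (intro power_mono) auto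
  also have "\<dots> \<le> U * (\<Sum>p\<in>P. (norm (t p))\<^sup>2)" unfolding U_def by (rule Cauchy_Schwarz_ineq_sum)
  also have "\<dots> \<le> U * (D * X)"
    using dual[of "\<lambda>i. cnj (s i)"] U0 by (intro mult_left_mono) (auto simp: t_def X_def)
  finally have XX: "X * X \<le> X * (D * U)" by (simp add: power2_eq_square mult_ac)
  have "X \<le> D * U"
  proof (cases "X = 0")
    case True
    then show ?thesis using assms(1) U0 by simp
  next
    case False
    then show ?thesis using XX X0 by simp
  qed
  then show ?thesis by (simp add: X_def U_def s_def)
qed


lemma nat_floor_bounds:
  assumes "x \<ge> 0"
  shows "real (nat \<lfloor>x\<rfloor>) \<le> x" "x < real (nat \<lfloor>x\<rfloor>) + 1"
proof -
  have "real (nat \<lfloor>x\<rfloor>) = of_int \<lfloor>x\<rfloor>" using assms by simp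
  then show "real (nat \<lfloor>x\<rfloor>) \<le> x" "x < real (nat \<lfloor>x\<rfloor>) + 1" by linarith+
qed

text \<open>Combines the sieved large sieve for \<open>z = \<lfloor>Q\<^sub>0\<rfloor>\<^sup>2\<close> with the lower bound for the sieve mass. The
  constants are \<open>17/3 * (4 + 3/2) = 187/6\<close> for the large sieve and \<open>4 * 4.7 * 2 = 188/5\<close> for the
  passage from \<open>1 / L\<close> to \<open>ln Q\<^sub>0 / ln N\<close>.\<close>
lemma prime_large_sieve_dual:
  fixes N Q\<^sub>0 :: real and b :: "nat \<times> nat \<Rightarrow> complex"
  assumes N: "N \<ge> 1000" and Q0: "2 \<le> Q\<^sub>0" "Q\<^sub>0 \<le> sqrt N"
    and \<alpha>: "\<And>i. i \<in> farey_index Q\<^sub>0 \<Longrightarrow> \<alpha> i \<in> arc Q\<^sub>0 (fst i) (snd i)"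
  shows "(\<Sum>p\<in>primes_upto N. (norm (\<Sum>i\<in>farey_index Q\<^sub>0. b i * e (\<alpha> i * real p)))\<^sup>2)
         \<le> 1200 * (N * ln Q\<^sub>0 / ln N) * (\<Sum>i\<in>farey_index Q\<^sub>0. (norm (b i))\<^sup>2)"
proof -
  define I where "I = farey_index Q\<^sub>0"
  define B where "B = (\<Sum>i\<in>I. (norm (b i))\<^sup>2)"
  define T where "T p = (\<Sum>i\<in>I. b i * e (\<alpha> i * real p))" for p :: nat
  define M where "M = nat \<lfloor>N\<rfloor>"
  define Q where "Q = nat \<lfloor>Q\<^sub>0\<rfloor>"
  define z where "z = Q\<^sup>2"
  have B0: "B \<ge> 0" by (simp add: B_def sum_nonneg)
  have M: "real M \<le> N" "N < real M + 1" "M > 0"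
    using nat_floor_bounds[of N] N by (auto simp: M_def[symmetric] intro: Nat.gr0I)
  have Q: "real Q \<le> Q\<^sub>0" "Q\<^sub>0 < real Q + 1" "Q \<ge> 2"
    using nat_floor_bounds[of Q\<^sub>0] Q0(1) by (auto simp: Q_def[symmetric])
  have lnN: "ln N > 0" using N by simp
  have lnQ: "ln Q\<^sub>0 \<ge> 2/3"
    using Q0(1) ln2_ge_two_thirds by (smt (verit) ln_le_cancel_iff)
  have z4: "z \<ge> 4" using power_mono[of 2 Q 2] Q by (simp add: z_def)
  have lnz: "ln (real z) \<le> 2 * ln Q\<^sub>0" using Q by (simp add: z_def ln_realpow)
  have cardI: "2 * card I \<le> z" unfolding I_def z_def by (rule card_farey_index_le[OF Q(3,1,2)])
  have "Q\<^sub>0\<^sup>2 \<le> (sqrt N)\<^sup>2" using Q0 by (intro power_mono) auto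
  then have QN: "Q\<^sub>0\<^sup>2 \<le> N" using N by simp
  have finI: "finite I" by (simp add: I_def)
  have primes: "primes_upto N = {p. prime p \<and> p \<le> M}"
    unfolding primes_upto_def M_def using N by (auto simp: le_nat_iff le_floor_iff)
  have sieve: "sieve_mass z R * (\<Sum>p | prime p \<and> R < p \<and> p \<le> M. (norm (T p))\<^sup>2) \<le> 187/6 * N * B"
    if R: "R ^ 4 \<le> M" "R \<ge> 1" for R
  proof -
    have "card S \<le> 4" if "S \<subseteq> I" "\<And>i. i \<in> S \<Longrightarrow> t \<le> \<alpha> i + of_int (k i) \<and> \<alpha> i + of_int (k i) < t + 1 / real M" for S t k
    proof (rule farey_arc_cluster[of Q\<^sub>0 M \<alpha> S t k])
      fix q q' :: nat assume "1 \<le> q" "real q \<le> Q\<^sub>0" "1 \<le> q'" "real q' \<le> Q\<^sub>0"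
      then have "real q * real q' \<le> Q\<^sub>0 * Q\<^sub>0" using Q0 by (intro mult_mono) auto
      also have "\<dots> < real M + 1" using QN M by (simp add: power2_eq_square)
      finally have "real (q * q') < real (M + 1)" by simp
      then have "q * q' < M + 1" by (simp only: of_nat_less_iff)
      then show "q * q' \<le> M" by simp
    qed (use that \<alpha> Q0 M in \<open>auto simp: I_def\<close>)
    then have "sieve_mass z R * (\<Sum>p | prime p \<and> R < p \<and> p \<le> M. (norm (T p))\<^sup>2)
        \<le> 17/3 * real M * (real 4 + 3 * real (card I) / real z) * B"
      unfolding T_def B_def using R M z4 finI by (intro sieved_dual_large_sieve) auto
    also have "\<dots> \<le> 17/3 * N * (11/2) * B"
    proof (intro mult_right_mono mult_mono B0)
      have "real (2 * card I) \<le> real z" using cardI by (simp only: of_nat_le_iff)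
      then show "real 4 + 3 * real (card I) / real z \<le> 11/2" using z4 by (simp add: field_simps)
    qed (use M N in auto)
    finally show ?thesis by simp
  qed
  have "(\<Sum>p | prime p \<and> p \<le> M. (norm (T p))\<^sup>2) \<le> 1200 * (N * ln Q\<^sub>0 / ln N) * B"
  proof (cases "Q\<^sub>0 ^ 4 \<le> N")
    case False
    have "ln N \<le> ln (Q\<^sub>0 ^ 4)" using False N by (intro ln_mono) auto
    also have "\<dots> = 4 * ln Q\<^sub>0" using Q0 by (simp add: ln_realpow)
    finally have "1 \<le> 4 * ln Q\<^sub>0 / ln N" using lnN by simp
    have "{p. prime p \<and> p \<le> M} = {p. prime p \<and> 1 < p \<and> p \<le> M}" by (auto dest: prime_gt_1_nat)
    then have "(\<Sum>p | prime p \<and> p \<le> M. (norm (T p))\<^sup>2) = 1 * (\<Sum>p | prime p \<and> 1 < p \<and> p \<le> M. (norm (T p))\<^sup>2)"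
      by simp
    also have "\<dots> \<le> sieve_mass z 1 * (\<Sum>p | prime p \<and> 1 < p \<and> p \<le> M. (norm (T p))\<^sup>2)"
      by (intro mult_right_mono sieve_mass_ge_1 sum_nonneg) auto
    also have "\<dots> \<le> 187/6 * N * B" using M by (intro sieve) auto
    also have "\<dots> \<le> 300 * N * B * 1" using N B0 by (simp add: mult_right_mono)
    also have "\<dots> \<le> 300 * N * B * (4 * ln Q\<^sub>0 / ln N)"
      using \<open>1 \<le> 4 * ln Q\<^sub>0 / ln N\<close> N B0 by (intro mult_left_mono) auto
    finally show ?thesis by (simp add: mult_ac)
  next
    case True
    define y where "y = root 4 N"
    have y: "y > 0" "y ^ 4 = N" using N by (auto simp: y_def)
    \<comment> \<open>The largest \<open>R\<close> with \<open>R^4 \<le> M\<close>; then \<open>(R + 1)^4\<close> exceeds \<open>N\<close>, so \<open>ln (R + 1) \<ge> ln N / 4\<close>.\<close>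
    define R where "R = nat \<lfloor>root 4 (real M)\<rfloor>"
    have x: "root 4 (real M) ^ 4 = real M" "root 4 (real M) \<ge> 0" by simp_all
    have "real R \<le> root 4 (real M)" "root 4 (real M) < real R + 1"
      unfolding R_def using nat_floor_bounds[OF x(2)] by auto
    then have "real R ^ 4 \<le> root 4 (real M) ^ 4" "root 4 (real M) ^ 4 < (real R + 1) ^ 4"
      using x(2) by (intro power_mono power_strict_mono; simp)+
    then have R4: "real R ^ 4 \<le> real M" "real M < (real R + 1) ^ 4" by (simp_all only: x(1))
    then have "real (R ^ 4) \<le> real M" "real M < real ((R + 1) ^ 4)" by (simp_all add: add.commute)
    then have RM: "R ^ 4 \<le> M" "M + 1 \<le> (R + 1) ^ 4" by (simp_all only: of_nat_le_iff of_nat_less_iff Suc_eq_plus1[symmetric] Suc_le_eq)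
    have R1: "R \<ge> 1"
    proof (rule ccontr)
      assume "\<not> R \<ge> 1"
      then have "R = 0" by simp
      then show False using RM(2) M(3) by simp
    qed
    have "N \<le> real (M + 1)" using M by simp
    also have "\<dots> \<le> real ((R + 1) ^ 4)" using RM(2) by (simp only: of_nat_le_iff)
    also have "\<dots> = (real R + 1) ^ 4" by (simp add: add.commute)
    finally have "ln N \<le> ln ((real R + 1) ^ 4)" using N by (intro ln_mono) auto
    also have "\<dots> = 4 * ln (real R + 1)" by (simp add: ln_realpow)
    also have "\<dots> \<le> 4 * (47/10 * ln (real z) * sieve_mass z R)" by (intro mult_left_mono sieve_mass_lower z4) simp
    also have "\<dots> \<le> 4 * (47/10 * (2 * ln Q\<^sub>0) * sieve_mass z R)"
      using lnz sieve_mass_nonneg by (intro mult_left_mono mult_right_mono) auto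
    finally have L: "ln N \<le> 188/5 * ln Q\<^sub>0 * sieve_mass z R" by simp
    let ?A = "{p. prime p \<and> R < p \<and> p \<le> M}" and ?C = "{p. prime p \<and> p \<le> M \<and> p \<le> R}"
    have "ln N * (\<Sum>p\<in>?A. (norm (T p))\<^sup>2) \<le> 188/5 * ln Q\<^sub>0 * sieve_mass z R * (\<Sum>p\<in>?A. (norm (T p))\<^sup>2)"
      by (intro mult_right_mono L sum_nonneg) auto
    also have "\<dots> = 188/5 * ln Q\<^sub>0 * (sieve_mass z R * (\<Sum>p\<in>?A. (norm (T p))\<^sup>2))" by simp
    also have "\<dots> \<le> 188/5 * ln Q\<^sub>0 * (187/6 * N * B)"
      using lnQ by (intro mult_left_mono sieve RM R1) auto
    also have "\<dots> = 17578/15 * (N * ln Q\<^sub>0 * B)" by simp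
    also have "\<dots> \<le> 1172 * (N * ln Q\<^sub>0 * B)" using lnQ N B0 by (intro mult_right_mono mult_nonneg_nonneg) auto
    also have "\<dots> = 1172 * (N * ln Q\<^sub>0) * B" by simp
    finally have big: "ln N * (\<Sum>p\<in>?A. (norm (T p))\<^sup>2) \<le> 1172 * (N * ln Q\<^sub>0) * B" .
    have T: "(norm (T p))\<^sup>2 \<le> real (card I) * B" for p
    proof -
      have "norm (T p) \<le> (\<Sum>i\<in>I. 1 * norm (b i))"
        unfolding T_def by (rule order.trans[OF norm_sum]) (simp add: norm_mult)
      then have "(norm (T p))\<^sup>2 \<le> (\<Sum>i\<in>I. 1 * norm (b i))\<^sup>2" by (intro power_mono) auto
      also have "\<dots> \<le> (\<Sum>i\<in>I. 1\<^sup>2) * (\<Sum>i\<in>I. (norm (b i))\<^sup>2)" by (rule Cauchy_Schwarz_ineq_sum)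
      finally show ?thesis by (simp add: B_def)
    qed
    have Ry: "real R \<le> y"
    proof (rule power_le_imp_le_base[of _ 3])
      show "real R ^ Suc 3 \<le> y ^ Suc 3" using R4(1) M y by (simp add: eval_nat_numeral)
    qed (use y in simp)
    have Qy: "Q\<^sub>0 \<le> y"
    proof (rule power_le_imp_le_base[of _ 3])
      show "Q\<^sub>0 ^ Suc 3 \<le> y ^ Suc 3" using True y by (simp add: eval_nat_numeral)
    qed (use y in simp)
    have cI: "2 * real (card I) \<le> y\<^sup>2"
    proof -
      have "real (2 * card I) \<le> real z" using cardI by (simp only: of_nat_le_iff)
      also have "\<dots> = (real Q)\<^sup>2" by (simp add: z_def)
      also have "\<dots> \<le> y\<^sup>2" using Q Qy by (intro power_mono) auto
      finally show ?thesis by simp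
    qed
    \<comment> \<open>The primes up to \<open>R\<close> are few enough for the trivial bound on each term.\<close>
    have "(\<Sum>p\<in>?C. (norm (T p))\<^sup>2) \<le> real (card ?C) * (real (card I) * B)"
      using sum_mono[of ?C "\<lambda>p. (norm (T p))\<^sup>2" "\<lambda>_. real (card I) * B"] T by simp
    also have "card ?C \<le> card {1..R}" by (intro card_mono) (auto dest: prime_ge_1_nat)
    then have "real (card ?C) * (real (card I) * B) \<le> y * (y\<^sup>2 / 2 * B)"
      using Ry cI B0 y by (intro mult_mono) auto
    finally have "ln N * (\<Sum>p\<in>?C. (norm (T p))\<^sup>2) \<le> ln N * (y * (y\<^sup>2 / 2 * B))" using lnN by (intro mult_left_mono) auto
    also have "ln N \<le> 4 * y"
    proof -
      have "ln N = ln (y ^ 4)" using y by simp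
      also have "\<dots> = 4 * ln y" using y(1) by (simp add: ln_realpow)
      also have "ln y \<le> y - 1" by (rule ln_le_minus_one[OF y(1)])
      finally show ?thesis by simp
    qed
    then have "ln N * (y * (y\<^sup>2 / 2 * B)) \<le> 4 * y * (y * (y\<^sup>2 / 2 * B))" using y B0 by (intro mult_right_mono) auto
    also have "\<dots> = 2 * N * B" unfolding y(2)[symmetric] by (simp add: eval_nat_numeral)
    also have "\<dots> \<le> 28 * (N * (2/3)) * B" using N B0 by (intro mult_right_mono) auto
    also have "\<dots> \<le> 28 * (N * ln Q\<^sub>0) * B" using lnQ N B0 by (intro mult_right_mono mult_left_mono) auto
    finally have small: "ln N * (\<Sum>p\<in>?C. (norm (T p))\<^sup>2) \<le> 28 * (N * ln Q\<^sub>0) * B" .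
    have "{p. prime p \<and> p \<le> M} = ?A \<union> ?C" by auto
    moreover have "finite ?A" "finite ?C" by (rule finite_subset[of _ "{..M}"]; auto)+
    ultimately have "(\<Sum>p | prime p \<and> p \<le> M. (norm (T p))\<^sup>2) = (\<Sum>p\<in>?A. (norm (T p))\<^sup>2) + (\<Sum>p\<in>?C. (norm (T p))\<^sup>2)"
      by (simp only:) (subst sum.union_disjoint, auto)
    then have "ln N * (\<Sum>p | prime p \<and> p \<le> M. (norm (T p))\<^sup>2) \<le> 1200 * (N * ln Q\<^sub>0) * B"
      using big small by (simp add: distrib_left)
    then have "(\<Sum>p | prime p \<and> p \<le> M. (norm (T p))\<^sup>2) \<le> 1200 * (N * ln Q\<^sub>0) * B / ln N"
      using lnN by (simp add: pos_le_divide_eq mult.commute)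
    then show ?thesis by simp
  qed
  then show ?thesis by (simp add: primes T_def B_def I_def)
qed

theorem corollary1p5:
  fixes N Q\<^sub>0 :: real and u :: "nat \<Rightarrow> complex"
  assumes "N \<ge> 1000" and "2 \<le> Q\<^sub>0" and "Q\<^sub>0 \<le> sqrt N"
  shows "(\<Sum>q\<in>{q::nat. 1 \<le> q \<and> real q \<le> Q\<^sub>0}. \<Sum>a\<in>{a::nat. 1 \<le> a \<and> a \<le> q \<and> coprime a q}.
            arc_max N u Q\<^sub>0 q a)
         \<le> 1200 * (N * ln Q\<^sub>0 / ln N) * (\<Sum>p\<in>primes_upto N. (norm (u p))\<^sup>2)"
proof -
  have "\<exists>\<alpha>. \<alpha> \<in> arc Q\<^sub>0 (fst i) (snd i) \<and> arc_max N u Q\<^sub>0 (fst i) (snd i) = (norm (prime_exp_sum N u \<alpha>))\<^sup>2" for i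
    using arc_max_attained[of Q\<^sub>0 "fst i" "snd i" N u] assms(2) by auto
  then obtain \<alpha> where \<alpha>: "\<And>i. \<alpha> i \<in> arc Q\<^sub>0 (fst i) (snd i)"
    "\<And>i. arc_max N u Q\<^sub>0 (fst i) (snd i) = (norm (prime_exp_sum N u (\<alpha> i)))\<^sup>2"
    by metis
  have fin: "finite {q. 1 \<le> q \<and> real q \<le> Q\<^sub>0}"
    by (rule finite_subset[of _ "{..nat \<lfloor>Q\<^sub>0\<rfloor>}"]) (auto simp: le_nat_iff le_floor_iff)
  have "(\<Sum>q\<in>{q::nat. 1 \<le> q \<and> real q \<le> Q\<^sub>0}. \<Sum>a\<in>{a::nat. 1 \<le> a \<and> a \<le> q \<and> coprime a q}. arc_max N u Q\<^sub>0 q a)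
      = (\<Sum>i\<in>farey_index Q\<^sub>0. arc_max N u Q\<^sub>0 (fst i) (snd i))"
    unfolding farey_index_def using fin by (subst sum.Sigma) (auto simp: case_prod_unfold)
  also have "\<dots> = (\<Sum>i\<in>farey_index Q\<^sub>0. (norm (\<Sum>p\<in>primes_upto N. u p * e (\<alpha> i * real p)))\<^sup>2)"
    by (simp only: \<alpha>(2) prime_exp_sum_def)
  also have "\<dots> \<le> 1200 * (N * ln Q\<^sub>0 / ln N) * (\<Sum>p\<in>primes_upto N. (norm (u p))\<^sup>2)"
  proof (rule dual_to_primal)
    show "0 \<le> 1200 * (N * ln Q\<^sub>0 / ln N)"
      using assms(1,2) by (intro mult_nonneg_nonneg divide_nonneg_nonneg) auto
  qed (rule prime_large_sieve_dual[OF assms \<alpha>(1)])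
  finally show ?thesis .
qed

end
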